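(* Let $E$ be a semi-simple fresco of rank $k$ and let $\lambda_1,\dots,\lambda_k$ be the numbers associated to a Jordan-Hölder sequence of $E$. Let $\mu_1,\dots,\mu_k$ be a twisted permutation of $\lambda_1,\dots,\lambda_k$, meaning that the sequence $(\mu_j+j)_{j\in[1,k]}$ is a permutation (in the usual sense) of the sequence $(\lambda_j+j)_{j\in[1,k]}$. Then there exists a Jordan-Hölder sequence of $E$ whose successive rank 1 quotients are isomorphic to $E_{\mu_1},\dots,E_{\mu_k}$, in this order.
   Context: $\tilde{\mathcal A}$ is the $\mathbb{C}$-algebra of formal series $\sum_{\nu\ge 0}P_\nu(a)b^\nu$, $P_\nu\in\mathbb{C}[x]$, with $ab-ba=b^2$, left and right multiplication by $a$ being continuous for the $b$-adic filtration. An (a,b)-module is a left $\tilde{\mathcal A}$-module free of finite rank over $\mathbb{C}[[b]]$; submodule means left $\tilde{\mathcal A}$-submodule. It has a simple pole if $aE\subset bE$; then its Bernstein polynomial is the minimal polynomial of $-b^{-1}a$ on $E/bE$. It is regular if it embeds in a simple pole (a,b)-module; its Bernstein polynomial is then that of its saturation $E^\sharp$ by $b^{-1}a$. It is geometric if regular with all roots of the Bernstein polynomial rational and strictly negative. A fresco is a geometric (a,b)-module generated by one element over $\tilde{\mathcal A}$. A submodule $F\subset E$ is normal if $F\cap bE=bF$. For $\mu\in\mathbb{C}$, $E_\mu:=\tilde{\mathcal A}/\tilde{\mathcal A}(a-\mu b)$; every regular rank 1 (a,b)-module is isomorphic to exactly one $E_\mu$. A Jordan-Hölder sequence of a rank $k$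 regular (a,b)-module $E$ is a sequence $0=F_0\subset F_1\subset\dots\subset F_k=E$ of normal submodules with $F_j/F_{j-1}$ of rank 1; its associated numbers $\lambda_1,\dots,\lambda_k$ are defined by $F_j/F_{j-1}\simeq E_{\lambda_j}$. A regular (a,b)-module is semi-simple if it is isomorphic to a submodule of a finite direct sum of regular rank 1 (a,b)-modules. *)

theory Defs
  imports
    Complex_Main
    "HOL-Computational_Algebra.Polynomial"
    "HOL-Computational_Algebra.Formal_Power_Series"
    "HOL-Library.FuncSet"
    "HOL-Combinatorics.Permutations"
    "HOL-Algebra.Module"
    "HOL-Algebra.AbelCoset"
begin

section \<open>The algebra of the variables \<open>a\<close> and \<open>b\<close>\<close>

text \<open>
  The series \<open>\<Sum>\<^sub>\<nu> P\<^sub>\<nu>(a) b\<^sup>\<nu>\<close> is encoded as the power series whose coefficient of index \<open>\<nu>\<close> is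
  the polynomial \<open>P\<^sub>\<nu>\<close>; powers of \<open>a\<close> stand to the left of powers of \<open>b\<close>. From
  \<open>a b - b a = b\<^sup>2\<close> one gets the reordering rule
  \<open>b\<^sup>i Q(a) = \<Sum>\<^sub>k C(-i, k) Q\<^sup>(\<^sup>k\<^sup>)(a) b\<^sup>i\<^sup>+\<^sup>k\<close>, with \<open>C\<close> the generalised binomial coefficient, and
  hence the product below. It is different from the commutative product \<open>(*)\<close> of the type
  \<open>complex poly fps\<close>; only the additive structure of that type is used for the algebra.
\<close>

type_synonym ab_series = "complex poly fps"

definition ab_mult :: "ab_series \<Rightarrow> ab_series \<Rightarrow> ab_series" where
  "ab_mult f g = Abs_fps (\<lambda>n. \<Sum>i\<le>n. \<Sum>k\<le>n - i.
     fps_nth f i * Polynomial.smult ((- of_nat i) gchoose k) ((pderiv ^^ k) (fps_nth g (n - i - k))))"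

definition ab_a :: ab_series where "ab_a = fps_const [:0, 1:]"

definition ab_b :: ab_series where "ab_b = fps_X"

definition ab_scalar :: "complex \<Rightarrow> ab_series" where "ab_scalar c = fps_const [:c:]"

text \<open>The inclusion of \<open>\<complex>[[b]]\<close>.\<close>

definition ab_of_b :: "complex fps \<Rightarrow> ab_series" where
  "ab_of_b f = Abs_fps (\<lambda>n. [:fps_nth f n:])"

definition Atilde :: "ab_series ring" where
  "Atilde = \<lparr>carrier = UNIV, mult = ab_mult, one = 1, zero = 0, add = (+)\<rparr>"

subsection \<open>Ring axioms and the defining relation\<close>

text \<open>
  For associativity the product is written as \<open>\<Sum>\<^sub>k (-1)\<^sup>k / k! \<delta>\<^sup>k f \<cdot> \<partial>\<^sup>k g\<close> with the commuting
  derivations \<open>\<delta> = b\<^sup>2 d/db\<close> and \<open>\<partial> = d/da\<close> of the commutative ring of power series.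
\<close>

definition ab_delta :: "ab_series \<Rightarrow> ab_series" where
  "ab_delta f = fps_X ^ 2 * fps_deriv f"

definition ab_del :: "ab_series \<Rightarrow> ab_series" where
  "ab_del f = Abs_fps (\<lambda>n. pderiv (fps_nth f n))"

lemma ab_delta_nth: "fps_nth (ab_delta f) n = of_nat (n - 1) * fps_nth f (n - 1)"
proof (cases n)
  case 0
  then show ?thesis by (simp add: ab_delta_def power2_eq_square)
next
  case (Suc m)
  then show ?thesis
    by (cases m) (auto simp add: ab_delta_def power2_eq_square mult.assoc)
qed

lemma ab_delta_pow_nth:
  "fps_nth ((ab_delta ^^ k) f) n =
     (if k \<le> n then [:pochhammer (of_nat (n - k)) k:] * fps_nth f (n - k) else 0)"
proof (induction k arbitrary: n)
  case 0
  then show ?case by simp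
next
  case (Suc k)
  show ?case
  proof (cases n)
    case 0
    then show ?thesis by (simp add: ab_delta_nth)
  next
    case (Suc m)
    have *: "[:pochhammer (of_nat (m - k)) (Suc k):] =
        of_nat m * ([:pochhammer (of_nat (m - k)) k:] :: complex poly)" if "k \<le> m"
      using that by (simp add: pochhammer_Suc of_nat_diff of_nat_poly)
    show ?thesis
      using Suc * by (auto simp add: ab_delta_nth Suc.IH mult.assoc)
  qed
qed

lemma ab_del_pow_nth: "fps_nth ((ab_del ^^ k) f) n = (pderiv ^^ k) (fps_nth f n)"
  by (induction k arbitrary: f) (auto simp add: ab_del_def)

lemma ab_delta_add: "ab_delta (f + g) = ab_delta f + ab_delta g"
  by (simp add: ab_delta_def algebra_simps)

lemma ab_delta_mult: "ab_delta (f * g) = ab_delta f * g + f * ab_delta g"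
  by (simp add: ab_delta_def algebra_simps)

lemma ab_del_add: "ab_del (f + g) = ab_del f + ab_del g"
  by (rule fps_ext) (simp add: ab_del_def pderiv_add)

lemma ab_del_mult: "ab_del (f * g) = ab_del f * g + f * ab_del g"
  unfolding ab_del_def fps_eq_iff fps_mult_nth fps_nth_Abs_fps fps_add_nth
    higher_pderiv_sum[of 1, simplified] pderiv_mult sum.distrib
  by (simp add: add.commute mult.commute)

lemma ab_delta_del: "ab_delta (ab_del f) = ab_del (ab_delta f)"
  by (rule fps_ext) (simp add: ab_del_def ab_delta_nth pderiv_mult)

lemma derivation_pow_mult:
  fixes D :: "'r::comm_ring_1 \<Rightarrow> 'r"
  assumes add: "\<And>f g. D (f + g) = D f + D g" and mult: "\<And>f g. D (f * g) = D f * g + f * D g"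
  shows "(D ^^ n) (f * g) = (\<Sum>m\<le>n. of_nat (n choose m) * ((D ^^ m) f * (D ^^ (n - m)) g))"
proof -
  have D0: "D 0 = 0"
    using add[of 0 0] by simp
  have Dsum: "D (sum h A) = (\<Sum>x\<in>A. D (h x))" for h :: "nat \<Rightarrow> 'r" and A
    by (induction A rule: infinite_finite_induct) (auto simp: D0 add)
  have D1: "D 1 = 0"
    using mult[of 1 1] by simp
  have Dnat: "D (of_nat k) = 0" for k
    by (induction k) (auto simp: D0 D1 add)
  show ?thesis
  proof (induction n)
    case 0
    then show ?case by simp
  next
    case (Suc n)
    let ?t = "\<lambda>m p. (D ^^ m) f * (D ^^ p) g"
    have "(D ^^ Suc n) (f * g) =
        (\<Sum>m\<le>n. of_nat (n choose m) * (?t (Suc m) (n - m) + ?t m (Suc (n - m))))"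
      by (simp add: Suc Dsum Dnat mult)
    also have "\<dots> = (\<Sum>m\<le>n. of_nat (n choose m) * ?t (Suc m) (n - m)) +
        (\<Sum>m\<le>n. of_nat (n choose m) * ?t m (Suc n - m))"
      by (simp add: distrib_left sum.distrib Suc_diff_le)
    also have "(\<Sum>m\<le>n. of_nat (n choose m) * ?t m (Suc n - m)) =
        (\<Sum>m\<le>Suc n. of_nat (n choose m) * ?t m (Suc n - m))"
      by (simp add: binomial_eq_0)
    also have "\<dots> = ?t 0 (Suc n) + (\<Sum>m\<le>n. of_nat (n choose Suc m) * ?t (Suc m) (n - m))"
      by (subst sum.atMost_Suc_shift) simp
    also have "(\<Sum>m\<le>n. of_nat (n choose m) * ?t (Suc m) (n - m)) + \<dots> =
        ?t 0 (Suc n) + (\<Sum>m\<le>n. of_nat (Suc n choose Suc m) * ?t (Suc m) (n - m))"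
      by (simp add: algebra_simps sum.distrib)
    also have "\<dots> = (\<Sum>m\<le>Suc n. of_nat (Suc n choose m) * ?t m (Suc n - m))"
      by (subst sum.atMost_Suc_shift) simp
    finally show ?case .
  qed
qed

definition ab_coef :: "nat \<Rightarrow> ab_series" where
  "ab_coef k = ab_scalar ((-1) ^ k / fact k)"

lemma ab_scalar_mult_nth: "fps_nth (ab_scalar c * f) n = Polynomial.smult c (fps_nth f n)"
  by (simp add: ab_scalar_def)

lemma smult_sum_right: "Polynomial.smult c (sum F A) = (\<Sum>x\<in>A. Polynomial.smult c (F x))"
  by (induction A rule: infinite_finite_induct) (auto simp: smult_add_right)

lemma ab_mult_nth_upto:
  assumes "n \<le> N"
  shows "fps_nth (ab_mult f g) n =
    (\<Sum>k\<le>N. fps_nth (ab_coef k * ((ab_delta ^^ k) f * (ab_del ^^ k) g)) n)"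
proof -
  let ?q = "\<lambda>k j. (pderiv ^^ k) (fps_nth g j)"
  have "fps_nth (ab_coef k * ((ab_delta ^^ k) f * (ab_del ^^ k) g)) n =
      (if k \<le> n then \<Sum>i\<le>n - k. fps_nth f i * Polynomial.smult ((- of_nat i) gchoose k) (?q k (n - i - k))
       else 0)" for k
  proof (cases "k \<le> n")
    case False
    then show ?thesis
      unfolding ab_coef_def ab_scalar_mult_nth by (simp add: fps_mult_nth ab_delta_pow_nth)
  next
    case True
    have "fps_nth ((ab_delta ^^ k) f * (ab_del ^^ k) g) n =
        (\<Sum>i=0..n. if k \<le> i then [:pochhammer (of_nat (i - k)) k:] * fps_nth f (i - k) * ?q k (n - i)
           else 0)"
      by (auto simp: fps_mult_nth ab_delta_pow_nth ab_del_pow_nth intro!: sum.cong)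
    also have "\<dots> = (\<Sum>i=k..n. [:pochhammer (of_nat (i - k)) k:] * fps_nth f (i - k) * ?q k (n - i))"
      by (rule sum.mono_neutral_cong_right) auto
    also have "\<dots> = (\<Sum>i\<le>n - k. [:pochhammer (of_nat i) k:] * fps_nth f i * ?q k (n - i - k))"
      using True
      by (intro sum.reindex_bij_witness[of _ "\<lambda>i. i + k" "\<lambda>i. i - k"])
        (auto simp: algebra_simps)
    finally show ?thesis
      using True by (simp add: ab_coef_def ab_scalar_mult_nth smult_sum_right gbinomial_pochhammer)
  qed
  then have "(\<Sum>k\<le>N. fps_nth (ab_coef k * ((ab_delta ^^ k) f * (ab_del ^^ k) g)) n) =
      (\<Sum>k\<le>n. \<Sum>i\<le>n - k. fps_nth f i * Polynomial.smult ((- of_nat i) gchoose k) (?q k (n - i - k)))"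
    using assms by simp (rule sum.mono_neutral_cong_right, auto)
  also have "\<dots> = (\<Sum>i\<le>n. \<Sum>k\<le>n - i. fps_nth f i * Polynomial.smult ((- of_nat i) gchoose k) (?q k (n - i - k)))"
    unfolding sum.Sigma[OF finite_atMost, OF ballI, OF finite_atMost]
    by (intro sum.reindex_bij_witness[of _ prod.swap prod.swap]) auto
  finally show ?thesis
    by (simp add: ab_mult_def)
qed

lemma ab_coef_mult: "ab_coef (m + p) * of_nat ((m + p) choose m) = ab_coef m * ab_coef p"
proof -
  have "(-1) ^ (m + p) / fact (m + p) * of_nat ((m + p) choose m) =
      (-1) ^ m / fact m * ((-1) ^ p / fact p :: complex)"
    by (simp add: binomial_fact power_add)
  then show ?thesis
    by (simp add: ab_coef_def ab_scalar_def fps_of_nat[symmetric] of_nat_poly mult_ac)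
qed

lemma ab_delta_pow_sum: "(ab_delta ^^ k) (sum F A) = (\<Sum>x\<in>A. (ab_delta ^^ k) (F x))"
  by (rule fps_ext) (simp add: ab_delta_pow_nth fps_sum_nth sum_distrib_left)

lemma ab_del_pow_sum: "(ab_del ^^ k) (sum F A) = (\<Sum>x\<in>A. (ab_del ^^ k) (F x))"
  by (rule fps_ext) (simp add: ab_del_pow_nth fps_sum_nth higher_pderiv_sum)

lemma ab_delta_pow_coef: "(ab_delta ^^ k) (ab_coef l * F) = ab_coef l * (ab_delta ^^ k) F"
  by (rule fps_ext) (simp add: ab_coef_def ab_delta_pow_nth ab_scalar_mult_nth)

lemma ab_del_pow_coef: "(ab_del ^^ k) (ab_coef l * F) = ab_coef l * (ab_del ^^ k) F"
  by (rule fps_ext) (simp add: ab_coef_def ab_del_pow_nth ab_scalar_mult_nth higher_pderiv_smult)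

lemma ab_delta_del_pow: "(ab_delta ^^ k) ((ab_del ^^ l) F) = (ab_del ^^ l) ((ab_delta ^^ k) F)"
proof -
  have 1: "(ab_delta ^^ k) (ab_del F) = ab_del ((ab_delta ^^ k) F)" for F
    by (induction k) (auto simp: ab_delta_del)
  show ?thesis
    by (induction l) (auto simp: 1)
qed

lemma fps_mult_nth_upto_cong:
  assumes "\<And>i. i \<le> n \<Longrightarrow> fps_nth F i = fps_nth F' i" "\<And>i. i \<le> n \<Longrightarrow> fps_nth G i = fps_nth G' i"
  shows "fps_nth (F * G) n = fps_nth (F' * G') n"
  unfolding fps_mult_nth by (rule sum.cong) (use assms in auto)

lemma sum_triangle_eq_square:
  fixes F :: "nat \<Rightarrow> nat \<Rightarrow> 'r::comm_monoid_add"
  assumes "\<And>i j. n < i + j \<Longrightarrow> F i j = 0"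
  shows "(\<Sum>k\<le>n. \<Sum>i\<le>k. F i (k - i)) = (\<Sum>i\<le>n. \<Sum>j\<le>n. F i j)"
proof -
  have "(\<Sum>i\<le>n. \<Sum>j\<le>n. F i j) = (\<Sum>(i, j)\<in>{..n} \<times> {..n}. F i j)"
    by (simp add: sum.cartesian_product)
  also have "\<dots> = (\<Sum>(i, j)\<in>{(i, j). i + j \<le> n}. F i j)"
    by (rule sum.mono_neutral_right) (auto intro: assms)
  finally show ?thesis
    by (simp add: sum.triangle_reindex_eq)
qed

lemma ab_mult_assoc: "ab_mult (ab_mult f g) h = ab_mult f (ab_mult g h)"
proof (rule fps_ext)
  fix n
  define T where "T f g = (\<Sum>k\<le>n. ab_coef k * ((ab_delta ^^ k) f * (ab_del ^^ k) g))" for f g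
  have T: "fps_nth (ab_mult f g) i = fps_nth (T f g) i" if "i \<le> n" for f g i
    using ab_mult_nth_upto[OF that] by (simp add: T_def fps_sum_nth)
  define S where "S l m p = ab_coef l * ab_coef m * ab_coef p * ((ab_delta ^^ (m + l)) f *
    ((ab_delta ^^ p) ((ab_del ^^ l) g) * (ab_del ^^ (m + p)) h))" for l m p
  have S0: "fps_nth (S l m p) n = 0" if "n < l + m + p" for l m p
  proof -
    have S': "S l m p = ab_scalar ((-1) ^ l / fact l * ((-1) ^ m / fact m) * ((-1) ^ p / fact p)) *
        ((ab_delta ^^ (m + l)) f * ((ab_delta ^^ p) ((ab_del ^^ l) g) * (ab_del ^^ (m + p)) h))"
      by (simp add: S_def ab_coef_def ab_scalar_def mult_ac)
    have "fps_nth ((ab_delta ^^ p) ((ab_del ^^ l) g) * (ab_del ^^ (m + p)) h) i = 0" if "i < p" for i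
      unfolding fps_mult_nth ab_delta_pow_nth using that by (auto intro!: sum.neutral)
    then have "fps_nth ((ab_delta ^^ (m + l)) f *
        ((ab_delta ^^ p) ((ab_del ^^ l) g) * (ab_del ^^ (m + p)) h)) n = 0"
      unfolding fps_mult_nth[of "(ab_delta ^^ (m + l)) f"] ab_delta_pow_nth[of _ f]
      using that by (intro sum.neutral) auto
    then show ?thesis
      by (simp only: S' ab_scalar_mult_nth smult_0_right)
  qed
  have "fps_nth (ab_mult (ab_mult f g) h) n =
      (\<Sum>k\<le>n. fps_nth (ab_coef k * ((ab_delta ^^ k) (T f g) * (ab_del ^^ k) h)) n)"
    unfolding ab_mult_nth_upto[OF order_refl]
    by (intro sum.cong fps_mult_nth_upto_cong refl) (auto simp: ab_delta_pow_nth T)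
  also have "\<dots> = (\<Sum>k\<le>n. \<Sum>m\<le>k. (\<Sum>l\<le>n. fps_nth (S l m (k - m)) n))"
  proof (rule sum.cong[OF refl])
    fix k
    have "ab_coef k * ((ab_delta ^^ k) (T f g) * (ab_del ^^ k) h) =
        (\<Sum>l\<le>n. \<Sum>m\<le>k. ab_coef l * (ab_coef (m + (k - m)) * of_nat ((m + (k - m)) choose m)) *
           ((ab_delta ^^ (m + l)) f * ((ab_delta ^^ (k - m)) ((ab_del ^^ l) g) * (ab_del ^^ k) h)))"
      unfolding T_def ab_delta_pow_sum ab_delta_pow_coef
      unfolding derivation_pow_mult[of ab_delta, OF ab_delta_add ab_delta_mult]
      by (simp add: sum_distrib_left sum_distrib_right mult_ac funpow_add)
    also have "\<dots> = (\<Sum>l\<le>n. \<Sum>m\<le>k. S l m (k - m))"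
      unfolding ab_coef_mult by (intro sum.cong refl) (simp add: S_def mult.assoc)
    also have "\<dots> = (\<Sum>m\<le>k. \<Sum>l\<le>n. S l m (k - m))"
      by (rule sum.swap)
    finally show "fps_nth (ab_coef k * ((ab_delta ^^ k) (T f g) * (ab_del ^^ k) h)) n =
        (\<Sum>m\<le>k. (\<Sum>l\<le>n. fps_nth (S l m (k - m)) n))"
      by (simp add: fps_sum_nth)
  qed
  also have "\<dots> = (\<Sum>m\<le>n. \<Sum>p\<le>n. \<Sum>l\<le>n. fps_nth (S l m p) n)"
    by (rule sum_triangle_eq_square) (auto intro!: sum.neutral S0)
  also have "\<dots> = (\<Sum>m\<le>n. \<Sum>l\<le>n. \<Sum>p\<le>n. fps_nth (S l m p) n)"
    by (intro sum.cong refl sum.swap)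
  also have "\<dots> = (\<Sum>l\<le>n. \<Sum>m\<le>n. \<Sum>p\<le>n. fps_nth (S l m p) n)"
    by (rule sum.swap)
  also have "\<dots> = (\<Sum>k\<le>n. \<Sum>l\<le>k. (\<Sum>p\<le>n. fps_nth (S l (k - l) p) n))"
    by (rule sum_triangle_eq_square[symmetric]) (auto intro!: sum.neutral S0)
  also have "\<dots> = (\<Sum>k\<le>n. fps_nth (ab_coef k * ((ab_delta ^^ k) f * (ab_del ^^ k) (T g h))) n)"
  proof (rule sum.cong[OF refl])
    fix k
    have dd: "(ab_del ^^ i) ((ab_del ^^ j) h) = (ab_del ^^ (i + j)) h" for i j
      by (simp add: funpow_add)
    have "ab_coef k * ((ab_delta ^^ k) f * (ab_del ^^ k) (T g h)) =
        (\<Sum>p\<le>n. \<Sum>l\<le>k. ab_coef p * (ab_coef (l + (k - l)) * of_nat ((l + (k - l)) choose l)) *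
           ((ab_delta ^^ k) f * ((ab_del ^^ l) ((ab_delta ^^ p) g) * (ab_del ^^ (k - l)) ((ab_del ^^ p) h))))"
      unfolding T_def ab_del_pow_sum ab_del_pow_coef
      unfolding derivation_pow_mult[of ab_del, OF ab_del_add ab_del_mult]
      by (simp add: sum_distrib_left sum_distrib_right mult_ac funpow_add)
    also have "\<dots> = (\<Sum>p\<le>n. \<Sum>l\<le>k. S l (k - l) p)"
      unfolding ab_coef_mult by (intro sum.cong refl) (simp add: S_def ab_delta_del_pow dd mult_ac)
    also have "\<dots> = (\<Sum>l\<le>k. \<Sum>p\<le>n. S l (k - l) p)"
      by (rule sum.swap)
    finally show "(\<Sum>l\<le>k. (\<Sum>p\<le>n. fps_nth (S l (k - l) p) n)) =
        fps_nth (ab_coef k * ((ab_delta ^^ k) f * (ab_del ^^ k) (T g h))) n"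
      by (simp add: fps_sum_nth)
  qed
  also have "\<dots> = fps_nth (ab_mult f (ab_mult g h)) n"
    unfolding ab_mult_nth_upto[OF order_refl]
    by (intro sum.cong fps_mult_nth_upto_cong refl) (auto simp: ab_del_pow_nth T)
  finally show "fps_nth (ab_mult (ab_mult f g) h) n = fps_nth (ab_mult f (ab_mult g h)) n" .
qed

lemma ab_mult_add_left: "ab_mult (f + g) h = ab_mult f h + ab_mult g h"
  by (rule fps_ext) (simp add: ab_mult_def distrib_right smult_add_right sum.distrib)

lemma ab_mult_add_right: "ab_mult f (g + h) = ab_mult f g + ab_mult f h"
  by (rule fps_ext)
    (simp add: ab_mult_def distrib_left higher_pderiv_add smult_add_right sum.distrib)

text \<open>The encoding of series: \<open>P(a)\<close> acts on the left and powers of \<open>b\<close> on the right as in the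
  commutative ring of power series.\<close>

lemma ab_mult_const_left: "ab_mult (fps_const P) f = fps_const P * f"
proof (rule fps_ext)
  fix n
  have "fps_nth (ab_mult (fps_const P) f) n =
      (\<Sum>k\<le>n. P * Polynomial.smult (0 gchoose k) ((pderiv ^^ k) (fps_nth f (n - k))))"
    unfolding ab_mult_def fps_nth_Abs_fps by (subst sum.mono_neutral_right[of _ "{0}"]) auto
  also have "\<dots> = P * fps_nth f n"
    by (subst sum.mono_neutral_right[of _ "{0}"]) (auto simp: gbinomial_0_left)
  finally show "fps_nth (ab_mult (fps_const P) f) n = fps_nth (fps_const P * f) n"
    by simp
qed

lemma higher_pderiv_1: "(pderiv ^^ k) (1 :: complex poly) = (if k = 0 then 1 else 0)"
  by (cases k) (simp_all add: funpow_Suc_right del: funpow.simps)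

lemma ab_mult_b_power_right: "ab_mult f (ab_b ^ m) = f * ab_b ^ m"
proof (rule fps_ext)
  fix n
  have "(\<Sum>k\<le>n - i. fps_nth f i * Polynomial.smult ((- of_nat i) gchoose k)
          ((pderiv ^^ k) (fps_nth (fps_X ^ m) (n - i - k)))) =
      (if n - i = m then fps_nth f i else 0)" for i
    by (subst sum.mono_neutral_right[of _ "{0}"]) (auto simp: higher_pderiv_1)
  then have "fps_nth (ab_mult f (ab_b ^ m)) n = (\<Sum>i\<le>n. if n - i = m then fps_nth f i else 0)"
    by (simp add: ab_mult_def ab_b_def)
  also have "\<dots> = (if m \<le> n then fps_nth f (n - m) else 0)"
  proof (cases "m \<le> n")
    case True
    then have "(\<Sum>i\<le>n. if n - i = m then fps_nth f i else 0) =
        (\<Sum>i\<le>n. if n - m = i then fps_nth f i else 0)"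
      by (intro sum.cong) auto
    then show ?thesis using True by simp
  qed (auto intro!: sum.neutral)
  finally show "fps_nth (ab_mult f (ab_b ^ m)) n = fps_nth (f * ab_b ^ m) n"
    by (simp add: ab_b_def fps_X_power_mult_right_nth)
qed

lemma ab_relation: "ab_mult ab_a ab_b - ab_mult ab_b ab_a = ab_mult ab_b ab_b"
proof -
  have pd: "(pderiv ^^ k) [:0, 1 :: complex:] = (if k = 0 then [:0, 1:] else if k = 1 then 1 else 0)" for k
  proof (cases k)
    case (Suc l)
    have "pderiv [:0, 1 :: complex:] = 1"
      by (simp add: pderiv_pCons one_pCons)
    then have "(pderiv ^^ k) [:0, 1 :: complex:] = (pderiv ^^ l) 1"
      by (simp add: Suc funpow_Suc_right del: funpow.simps)
    then show ?thesis by (simp add: Suc higher_pderiv_1)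
  qed simp
  have "fps_nth (ab_mult ab_b ab_a) n = fps_nth (ab_a * ab_b - ab_b * ab_b) n" for n
  proof (cases n)
    case 0
    then show ?thesis by (simp add: ab_mult_def ab_b_def)
  next
    case (Suc m)
    have "fps_nth (ab_mult ab_b ab_a) n =
        (\<Sum>k\<le>m. Polynomial.smult (- 1 gchoose k) ((pderiv ^^ k) (fps_nth ab_a (m - k))))"
      unfolding ab_mult_def fps_nth_Abs_fps
      by (subst sum.mono_neutral_right[of _ "{1}"]) (auto simp: ab_b_def Suc)
    also have "\<dots> = Polynomial.smult (- 1 gchoose m) ((pderiv ^^ m) [:0, 1:])"
      by (subst sum.mono_neutral_right[of _ "{m}"]) (auto simp: ab_a_def)
    also have "\<dots> = fps_nth (ab_a * ab_b - ab_b * ab_b) n"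
      by (auto simp: pd Suc ab_a_def ab_b_def one_pCons)
    finally show ?thesis .
  qed
  then have "ab_mult ab_b ab_a = ab_a * ab_b - ab_b * ab_b"
    by (rule fps_ext)
  then show ?thesis
    using ab_mult_b_power_right[of _ 1] by simp
qed

text \<open>Continuity for the \<open>b\<close>-adic filtration.\<close>

lemma ab_mult_filtration:
  assumes "\<And>i. i < N \<Longrightarrow> fps_nth f i = 0" and "n < N"
  shows "fps_nth (ab_mult f g) n = 0" and "fps_nth (ab_mult g f) n = 0"
  using assms by (auto simp: ab_mult_def intro!: sum.neutral)

lemma ring_Atilde: "ring Atilde"
proof (rule ringI)
  have "\<exists>y. y + x = 0" for x :: ab_series
    by (rule exI[of _ "- x"]) simp
  then show "abelian_group Atilde"
    by (intro abelian_groupI) (auto simp: Atilde_def algebra_simps)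
  show "Group.monoid Atilde"
    using ab_mult_const_left[of 1] ab_mult_b_power_right[of _ 0]
    by (intro Group.monoidI) (auto simp: Atilde_def ab_mult_assoc)
qed (auto simp: Atilde_def ab_mult_add_left ab_mult_add_right)

section \<open>Left modules over a ring\<close>

text \<open>
  The locale \<^locale>\<open>module\<close> asks for a commutative ring of scalars. As for \<^locale>\<open>module\<close>, the
  multiplicative fields of the record \<open>M\<close> play no role.
\<close>

locale left_module = R?: ring R + M?: abelian_group M
  for R (structure) and M :: "('r, 'm, 'x) module_scheme" (structure) +
  assumes smult_closed [simp, intro]:
      "\<lbrakk>r \<in> carrier R; x \<in> carrier M\<rbrakk> \<Longrightarrow> r \<odot>\<^bsub>M\<^esub> x \<in> carrier M"
    and smult_l_distr:
      "\<lbrakk>r \<in> carrier R; s \<in> carrier R; x \<in> carrier M\<rbrakk> \<Longrightarrow>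
       (r \<oplus> s) \<odot>\<^bsub>M\<^esub> x = r \<odot>\<^bsub>M\<^esub> x \<oplus>\<^bsub>M\<^esub> s \<odot>\<^bsub>M\<^esub> x"
    and smult_r_distr:
      "\<lbrakk>r \<in> carrier R; x \<in> carrier M; y \<in> carrier M\<rbrakk> \<Longrightarrow>
       r \<odot>\<^bsub>M\<^esub> (x \<oplus>\<^bsub>M\<^esub> y) = r \<odot>\<^bsub>M\<^esub> x \<oplus>\<^bsub>M\<^esub> r \<odot>\<^bsub>M\<^esub> y"
    and smult_assoc1:
      "\<lbrakk>r \<in> carrier R; s \<in> carrier R; x \<in> carrier M\<rbrakk> \<Longrightarrow>
       (r \<otimes> s) \<odot>\<^bsub>M\<^esub> x = r \<odot>\<^bsub>M\<^esub> (s \<odot>\<^bsub>M\<^esub> x)"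
    and smult_one [simp]: "x \<in> carrier M \<Longrightarrow> \<one> \<odot>\<^bsub>M\<^esub> x = x"

definition lmodule_hom ::
  "('r, 'y) ring_scheme \<Rightarrow> ('r, 'm) module \<Rightarrow> ('r, 'n) module \<Rightarrow> ('m \<Rightarrow> 'n) set" where
  "lmodule_hom R M N = {h \<in> carrier M \<rightarrow> carrier N.
     (\<forall>x\<in>carrier M. \<forall>y\<in>carrier M. h (x \<oplus>\<^bsub>M\<^esub> y) = h x \<oplus>\<^bsub>N\<^esub> h y) \<and>
     (\<forall>r\<in>carrier R. \<forall>x\<in>carrier M. h (r \<odot>\<^bsub>M\<^esub> x) = r \<odot>\<^bsub>N\<^esub> h x)}"

definition lmodule_isomorphic ::
  "('r, 'y) ring_scheme \<Rightarrow> ('r, 'm) module \<Rightarrow> ('r, 'n) module \<Rightarrow> bool" where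
  "lmodule_isomorphic R M N \<longleftrightarrow>
     (\<exists>h\<in>lmodule_hom R M N. bij_betw h (carrier M) (carrier N))"

definition restrict_module :: "('r, 'm) module \<Rightarrow> 'm set \<Rightarrow> ('r, 'm) module" where
  "restrict_module M N = M\<lparr>carrier := N\<rparr>"

definition quot_module :: "('r, 'm) module \<Rightarrow> 'm set \<Rightarrow> ('r, 'm set) module" where
  "quot_module M N = \<lparr>carrier = a_rcosets\<^bsub>M\<^esub> N, mult = undefined, one = undefined,
     zero = N, add = set_add M, smult = (\<lambda>r X. \<Union>x\<in>X. N +>\<^bsub>M\<^esub> (r \<odot>\<^bsub>M\<^esub> x))\<rparr>"

definition direct_sum_module :: "nat \<Rightarrow> (nat \<Rightarrow> ('r, 'm) module) \<Rightarrow> ('r, nat \<Rightarrow> 'm) module" where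
  "direct_sum_module n M = \<lparr>carrier = (\<Pi>\<^sub>E i\<in>{..<n}. carrier (M i)),
     mult = undefined, one = undefined, zero = (\<lambda>i\<in>{..<n}. \<zero>\<^bsub>M i\<^esub>),
     add = (\<lambda>x y. \<lambda>i\<in>{..<n}. x i \<oplus>\<^bsub>M i\<^esub> y i), smult = (\<lambda>r x. \<lambda>i\<in>{..<n}. r \<odot>\<^bsub>M i\<^esub> x i)\<rparr>"

lemma quot_module_left_module:
  assumes "left_module R M" and "submodule N R M"
  shows "left_module R (quot_module M N)"
proof -
  interpret left_module R M by fact
  interpret N: submodule N R M by fact
  interpret N: abelian_subgroup N M
    by (rule abelian_subgroupI3)
      (auto intro: additive_subgroup.intro N.subgroup_axioms M.abelian_group_axioms)
  let ?Q = "quot_module M N"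
  have carr: "carrier ?Q = {N +>\<^bsub>M\<^esub> x |x. x \<in> carrier M}"
    by (auto simp: quot_module_def A_RCOSETS_def')
  have add: "(N +>\<^bsub>M\<^esub> x) \<oplus>\<^bsub>?Q\<^esub> (N +>\<^bsub>M\<^esub> y) = N +>\<^bsub>M\<^esub> (x \<oplus>\<^bsub>M\<^esub> y)"
    if "x \<in> carrier M" "y \<in> carrier M" for x y
    using that by (simp add: quot_module_def N.a_rcos_sum)
  have zero: "\<zero>\<^bsub>?Q\<^esub> = N +>\<^bsub>M\<^esub> \<zero>\<^bsub>M\<^esub>"
    by (simp add: quot_module_def N.a_subset)
  have smult: "r \<odot>\<^bsub>?Q\<^esub> (N +>\<^bsub>M\<^esub> x) = N +>\<^bsub>M\<^esub> (r \<odot>\<^bsub>M\<^esub> x)"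
    if "r \<in> carrier R" "x \<in> carrier M" for r x
  proof -
    have "N +>\<^bsub>M\<^esub> (r \<odot>\<^bsub>M\<^esub> y) = N +>\<^bsub>M\<^esub> (r \<odot>\<^bsub>M\<^esub> x)" if y: "y \<in> N +>\<^bsub>M\<^esub> x" for y
    proof -
      obtain n where n: "n \<in> N" "y = n \<oplus>\<^bsub>M\<^esub> x"
        using y by (auto simp: a_r_coset_def')
      then have "r \<odot>\<^bsub>M\<^esub> y = r \<odot>\<^bsub>M\<^esub> n \<oplus>\<^bsub>M\<^esub> r \<odot>\<^bsub>M\<^esub> x"
        using \<open>r \<in> carrier R\<close> \<open>x \<in> carrier M\<close> N.a_Hcarr by (simp add: smult_r_distr)
      then have "r \<odot>\<^bsub>M\<^esub> y \<in> N +>\<^bsub>M\<^esub> (r \<odot>\<^bsub>M\<^esub> x)"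
        using n \<open>r \<in> carrier R\<close> by (auto simp: a_r_coset_def')
      then show ?thesis
        using \<open>r \<in> carrier R\<close> \<open>x \<in> carrier M\<close>
        by (intro N.a_repr_independence'[symmetric]) auto
    qed
    moreover have "x \<in> N +>\<^bsub>M\<^esub> x"
      using \<open>x \<in> carrier M\<close> by (rule N.a_rcos_self)
    ultimately have "(\<Union>y\<in>N +>\<^bsub>M\<^esub> x. N +>\<^bsub>M\<^esub> (r \<odot>\<^bsub>M\<^esub> y)) = N +>\<^bsub>M\<^esub> (r \<odot>\<^bsub>M\<^esub> x)"
      by blast
    then show ?thesis
      by (simp add: quot_module_def)
  qed
  have "abelian_group ?Q"
  proof (rule abelian_groupI)
    fix X assume "X \<in> carrier ?Q"
    then obtain x where "x \<in> carrier M" "X = N +>\<^bsub>M\<^esub> x"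
      by (auto simp: carr)
    then show "\<exists>Y\<in>carrier ?Q. Y \<oplus>\<^bsub>?Q\<^esub> X = \<zero>\<^bsub>?Q\<^esub>"
      by (intro bexI[of _ "N +>\<^bsub>M\<^esub> (\<ominus>\<^bsub>M\<^esub> x)"]) (auto simp: add zero carr M.l_neg)
  next
    show "\<zero>\<^bsub>?Q\<^esub> \<in> carrier ?Q"
      unfolding zero carr by blast
  next
    fix X Y assume "X \<in> carrier ?Q" "Y \<in> carrier ?Q"
    then obtain x y where "x \<in> carrier M" "X = N +>\<^bsub>M\<^esub> x" "y \<in> carrier M" "Y = N +>\<^bsub>M\<^esub> y"
      by (auto simp: carr)
    then show "X \<oplus>\<^bsub>?Q\<^esub> Y \<in> carrier ?Q" and "X \<oplus>\<^bsub>?Q\<^esub> Y = Y \<oplus>\<^bsub>?Q\<^esub> X"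
      by (auto simp: add carr M.a_comm)
  qed (auto simp: carr add zero M.a_assoc)
  then show ?thesis
    unfolding left_module_def left_module_axioms_def
  proof (intro conjI allI impI)
    show "ring R" ..
  qed (auto simp: carr add smult smult_l_distr smult_r_distr smult_assoc1)
qed

section \<open>(a,b)-modules\<close>

text \<open>\<open>is_b_basis E k e\<close>: the family \<open>e 0, \<dots>, e (k - 1)\<close> is a basis of \<open>E\<close> over \<open>\<complex>[[b]]\<close>.\<close>

definition is_b_basis :: "(ab_series, 'm) module \<Rightarrow> nat \<Rightarrow> (nat \<Rightarrow> 'm) \<Rightarrow> bool" where
  "is_b_basis E k e \<longleftrightarrow> e \<in> {..<k} \<rightarrow> carrier E \<and>
     (\<forall>x\<in>carrier E. \<exists>!c. c \<in> {..<k} \<rightarrow>\<^sub>E UNIV \<and>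
        x = (\<Oplus>\<^bsub>E\<^esub>i\<in>{..<k}. ab_of_b (c i) \<odot>\<^bsub>E\<^esub> e i))"

definition ab_module_of_rank :: "nat \<Rightarrow> (ab_series, 'm) module \<Rightarrow> bool" where
  "ab_module_of_rank k E \<longleftrightarrow> left_module Atilde E \<and> (\<exists>e. is_b_basis E k e)"

definition ab_module :: "(ab_series, 'm) module \<Rightarrow> bool" where
  "ab_module E \<longleftrightarrow> (\<exists>k. ab_module_of_rank k E)"

definition b_image :: "(ab_series, 'm) module \<Rightarrow> 'm set \<Rightarrow> 'm set" where
  "b_image E F = (\<lambda>x. ab_b \<odot>\<^bsub>E\<^esub> x) ` F"

definition simple_pole :: "(ab_series, 'm) module \<Rightarrow> bool" where
  "simple_pole E \<longleftrightarrow> ab_module E \<and>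
     (\<lambda>x. ab_a \<odot>\<^bsub>E\<^esub> x) ` carrier E \<subseteq> b_image E (carrier E)"

text \<open>
  Every (a,b)-module is isomorphic to one whose elements are the coordinate vectors in
  \<open>\<complex>[[b]]\<^sup>k\<close>, extended by \<open>0\<close> (lemma \<open>ab_module_coordinates\<close>). Hence quantifying over
  \<open>coord_module\<close> amounts to quantifying over all (a,b)-modules.
\<close>

type_synonym coord_module = "(ab_series, nat \<Rightarrow> complex fps) module"

lemma ab_module_coordinates:
  assumes "ab_module_of_rank k E"
  shows "\<exists>M :: coord_module. ab_module_of_rank k M \<and>
    carrier M = {x. \<forall>i\<ge>k. x i = 0} \<and> lmodule_isomorphic Atilde E M"
proof -
  interpret left_module Atilde E
    using assms by (simp add: ab_module_of_rank_def)
  obtain e where e: "is_b_basis E k e"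
    using assms by (auto simp: ab_module_of_rank_def)
  define S :: "(nat \<Rightarrow> complex fps) set" where "S = {x. \<forall>i\<ge>k. x i = 0}"
  define g where "g c = (\<Oplus>\<^bsub>E\<^esub>i\<in>{..<k}. ab_of_b (c i) \<odot>\<^bsub>E\<^esub> e i)" for c
  have e_carr: "e i \<in> carrier E" if "i < k" for i
    using e that by (auto simp: is_b_basis_def)
  have UN: "r \<in> carrier Atilde" for r
    by (simp add: Atilde_def)
  have g_carr: "g c \<in> carrier E" for c
    unfolding g_def by (rule M.finsum_closed) (auto intro: e_carr UN)
  have g_cong: "g c = g d" if "\<And>i. i < k \<Longrightarrow> c i = d i" for c d
    unfolding g_def using that by (intro M.finsum_cong') (auto intro: e_carr UN)
  have ex1: "\<exists>!c. c \<in> {..<k} \<rightarrow>\<^sub>E UNIV \<and> x = g c" if "x \<in> carrier E" for x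
    using e that unfolding is_b_basis_def g_def by blast
  have bij: "bij_betw g S (carrier E)"
  proof (rule bij_betwI')
    fix c d assume cd: "c \<in> S" "d \<in> S"
    show "(g c = g d) = (c = d)"
    proof
      assume *: "g c = g d"
      have "g c = g (restrict c {..<k})"
        by (rule g_cong) simp
      moreover have "g c = g (restrict d {..<k})"
        unfolding * by (rule g_cong) simp
      ultimately have "restrict c {..<k} = restrict d {..<k}"
        using ex1[OF g_carr, of c] by (metis UNIV_I restrict_PiE_iff)
      then have "c i = d i" if "i < k" for i
        using that by (metis lessThan_iff restrict_apply')
      moreover have "c i = d i" if "\<not> i < k" for i
        using that cd by (simp add: S_def)
      ultimately show "c = d" by blast
    qed simp
  next
    fix x assume "x \<in> carrier E"
    then obtain c where "x = g c" using ex1 by blast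
    also have "g c = g (\<lambda>i. if i < k then c i else 0)" by (rule g_cong) simp
    finally show "\<exists>c\<in>S. x = g c"
      by (rule bexI[of _ "\<lambda>i. if i < k then c i else 0"]) (simp add: S_def)
  qed (rule g_carr)
  define h where "h = inv_into S g"
  have hg [simp]: "h (g c) = c" if "c \<in> S" for c
    unfolding h_def using bij that by (simp add: bij_betw_def)
  have gh [simp]: "g (h x) = x" if "x \<in> carrier E" for x
    unfolding h_def using bij that by (simp add: bij_betw_def f_inv_into_f)
  have h_S [simp]: "h x \<in> S" if "x \<in> carrier E" for x
    unfolding h_def using bij that by (metis bij_betw_def inv_into_into)
  define M :: coord_module where "M = \<lparr>carrier = S, mult = undefined, one = undefined,
    zero = h \<zero>\<^bsub>E\<^esub>, add = (\<lambda>x y. h (g x \<oplus>\<^bsub>E\<^esub> g y)), smult = (\<lambda>r x. h (r \<odot>\<^bsub>E\<^esub> g x))\<rparr>"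
  have M_simps [simp]: "carrier M = S" "\<zero>\<^bsub>M\<^esub> = h \<zero>\<^bsub>E\<^esub>" "x \<oplus>\<^bsub>M\<^esub> y = h (g x \<oplus>\<^bsub>E\<^esub> g y)"
    "r \<odot>\<^bsub>M\<^esub> x = h (r \<odot>\<^bsub>E\<^esub> g x)" for x y r
    by (simp_all add: M_def)
  note [simp] = g_carr UN
  have ab: "abelian_group M"
  proof (rule abelian_groupI)
    fix x assume "x \<in> carrier M"
    then show "\<exists>y\<in>carrier M. y \<oplus>\<^bsub>M\<^esub> x = \<zero>\<^bsub>M\<^esub>"
      by (intro bexI[of _ "h (\<ominus>\<^bsub>E\<^esub> g x)"]) (auto simp: M.l_neg)
  qed (auto simp: M.a_ac)
  then interpret M': abelian_group M .
  have lm: "left_module Atilde M"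
    unfolding left_module_def left_module_axioms_def
    by (intro conjI allI impI R.ring_axioms ab)
      (auto simp: smult_l_distr smult_r_distr smult_assoc1)
  have fs: "(\<Oplus>\<^bsub>M\<^esub>i\<in>A. h (f i)) = h (\<Oplus>\<^bsub>E\<^esub>i\<in>A. f i)"
    if "finite A" "f \<in> A \<rightarrow> carrier E" for A :: "nat set" and f
    using that
  proof (induction A rule: finite_induct)
    case (insert a A)
    then have "(\<lambda>i. h (f i)) \<in> A \<rightarrow> carrier M" "f \<in> A \<rightarrow> carrier E" "f a \<in> carrier E"
      by (auto simp: Pi_iff)
    with insert show ?case
      by (simp add: M'.finsum_insert M.finsum_insert)
  qed simp
  have "(\<Oplus>\<^bsub>M\<^esub>i\<in>{..<k}. ab_of_b (c i) \<odot>\<^bsub>M\<^esub> h (e i)) = h (g c)" for c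
  proof -
    have "(\<Oplus>\<^bsub>M\<^esub>i\<in>{..<k}. ab_of_b (c i) \<odot>\<^bsub>M\<^esub> h (e i)) =
        (\<Oplus>\<^bsub>M\<^esub>i\<in>{..<k}. h (ab_of_b (c i) \<odot>\<^bsub>E\<^esub> e i))"
      by (rule M'.finsum_cong') (auto simp: e_carr)
    also have "\<dots> = h (g c)"
      unfolding g_def by (rule fs) (auto simp: e_carr)
    finally show ?thesis .
  qed
  moreover have "\<exists>!c. c \<in> {..<k} \<rightarrow>\<^sub>E UNIV \<and> x = h (g c)" if "x \<in> S" for x
    using ex1[OF g_carr, of x] that by (metis g_carr gh hg)
  ultimately have "is_b_basis M k (\<lambda>i. h (e i))"
    by (auto simp: is_b_basis_def e_carr simp del: M_simps(4))
  moreover have "h \<in> lmodule_hom Atilde E M"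
    by (auto simp: lmodule_hom_def)
  moreover have "bij_betw h (carrier E) (carrier M)"
    unfolding h_def M_simps by (rule bij_betw_inv_into[OF bij])
  ultimately show ?thesis
    using lm by (intro exI[of _ M]) (auto simp: ab_module_of_rank_def lmodule_isomorphic_def S_def)
qed

section \<open>Regularity, saturation and Bernstein polynomial\<close>

definition ab_embedding ::
  "(ab_series, 'm) module \<Rightarrow> (ab_series, 'n) module \<Rightarrow> ('m \<Rightarrow> 'n) \<Rightarrow> bool" where
  "ab_embedding E G j \<longleftrightarrow> j \<in> lmodule_hom Atilde E G \<and> inj_on j (carrier E)"

definition ab_regular :: "(ab_series, 'm) module \<Rightarrow> bool" where
  "ab_regular E \<longleftrightarrow> ab_module E \<and> (\<exists>(G :: coord_module) j. simple_pole G \<and> ab_embedding E G j)"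

text \<open>The map \<open>b\<^sup>-\<^sup>1a\<close> of a simple pole (a,b)-module.\<close>

definition b_inv_a :: "(ab_series, 'm) module \<Rightarrow> 'm \<Rightarrow> 'm" where
  "b_inv_a E x = (THE y. y \<in> carrier E \<and> ab_b \<odot>\<^bsub>E\<^esub> y = ab_a \<odot>\<^bsub>E\<^esub> x)"

text \<open>\<open>q(T)v = 0\<close> for all \<open>v \<in> V\<close>, where \<open>V\<close> is seen as a complex vector space.\<close>

definition annihilates :: "(ab_series, 'v) module \<Rightarrow> ('v \<Rightarrow> 'v) \<Rightarrow> complex poly \<Rightarrow> bool" where
  "annihilates V T q \<longleftrightarrow> (\<forall>v\<in>carrier V.
     (\<Oplus>\<^bsub>V\<^esub>i\<in>{..degree q}. ab_scalar (coeff q i) \<odot>\<^bsub>V\<^esub> (T ^^ i) v) = \<zero>\<^bsub>V\<^esub>)"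

definition minimal_polynomial :: "(ab_series, 'v) module \<Rightarrow> ('v \<Rightarrow> 'v) \<Rightarrow> complex poly" where
  "minimal_polynomial V T =
     (THE p. lead_coeff p = 1 \<and> (\<forall>q. annihilates V T q \<longleftrightarrow> p dvd q))"

text \<open>The minimal polynomial of the map induced by \<open>-b\<^sup>-\<^sup>1a\<close> on \<open>E/bE\<close>.\<close>

definition simple_pole_bernstein :: "(ab_series, 'm) module \<Rightarrow> complex poly" where
  "simple_pole_bernstein E =
     minimal_polynomial (quot_module E (b_image E (carrier E)))
       (\<lambda>X. \<Union>x\<in>X. b_image E (carrier E) +>\<^bsub>E\<^esub> (\<ominus>\<^bsub>E\<^esub> b_inv_a E x))"

text \<open>The saturation by \<open>b\<^sup>-\<^sup>1a\<close> of a submodule \<open>F\<close> of a simple pole (a,b)-module \<open>G\<close>.\<close>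

definition saturation :: "(ab_series, 'm) module \<Rightarrow> 'm set \<Rightarrow> 'm set" where
  "saturation G F = \<Inter>{S. submodule S Atilde G \<and> F \<subseteq> S \<and> (\<forall>x\<in>S. b_inv_a G x \<in> S)}"

text \<open>
  The saturation \<open>E\<^sup>\<sharp>\<close> is formed inside any simple pole (a,b)-module containing \<open>E\<close>; up to
  isomorphism it does not depend on the choice, being the saturation of \<open>E\<close> in \<open>E[b\<^sup>-\<^sup>1]\<close>.
\<close>

definition bernstein_poly :: "(ab_series, 'm) module \<Rightarrow> complex poly" where
  "bernstein_poly E = (THE p. \<exists>(G :: coord_module) j. simple_pole G \<and> ab_embedding E G j \<and>
     p = simple_pole_bernstein (restrict_module G (saturation G (j ` carrier E))))"

definition geometric :: "(ab_series, 'm) module \<Rightarrow> bool" where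
  "geometric E \<longleftrightarrow> ab_regular E \<and>
     (\<forall>z. poly (bernstein_poly E) z = 0 \<longrightarrow> (\<exists>q::rat. q < 0 \<and> z = of_rat q))"

definition fresco :: "(ab_series, 'm) module \<Rightarrow> bool" where
  "fresco E \<longleftrightarrow> geometric E \<and>
     (\<exists>e\<in>carrier E. carrier E = (\<lambda>u. u \<odot>\<^bsub>E\<^esub> e) ` carrier Atilde)"

section \<open>Jordan-Hoelder sequences and semi-simplicity\<close>

definition normal_submodule :: "(ab_series, 'm) module \<Rightarrow> 'm set \<Rightarrow> bool" where
  "normal_submodule E F \<longleftrightarrow>
     submodule F Atilde E \<and> F \<inter> b_image E (carrier E) = b_image E F"

definition Atilde_module :: "(ab_series, ab_series) module" where
  "Atilde_module = \<lparr>carrier = UNIV, mult = ab_mult, one = 1, zero = 0, add = (+), smult = ab_mult\<rparr>"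

text \<open>\<open>E\<^sub>\<mu> = A/A(a - \<mu>b)\<close> for the algebra \<open>A\<close> of series.\<close>

definition E_rank1 :: "complex \<Rightarrow> (ab_series, ab_series set) module" where
  "E_rank1 \<mu> = quot_module Atilde_module
     (range (\<lambda>u. ab_mult u (ab_a - ab_mult (ab_scalar \<mu>) ab_b)))"

text \<open>The quotient \<open>F\<^sub>j/F\<^sub>j\<^sub>-\<^sub>1\<close>, for \<open>j \<ge> 1\<close>.\<close>

definition graded_piece ::
  "(ab_series, 'm) module \<Rightarrow> (nat \<Rightarrow> 'm set) \<Rightarrow> nat \<Rightarrow> (ab_series, 'm set) module" where
  "graded_piece E F j = quot_module (restrict_module E (F j)) (F (j - 1))"

definition jordan_hoelder :: "(ab_series, 'm) module \<Rightarrow> nat \<Rightarrow> (nat \<Rightarrow> 'm set) \<Rightarrow> bool" where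
  "jordan_hoelder E k F \<longleftrightarrow> F 0 = {\<zero>\<^bsub>E\<^esub>} \<and> F k = carrier E \<and>
     (\<forall>j\<le>k. normal_submodule E (F j)) \<and>
     (\<forall>j\<in>{1..k}. F (j - 1) \<subseteq> F j \<and> ab_module_of_rank 1 (graded_piece E F j))"

definition quotients_isomorphic ::
  "(ab_series, 'm) module \<Rightarrow> nat \<Rightarrow> (nat \<Rightarrow> 'm set) \<Rightarrow> (nat \<Rightarrow> complex) \<Rightarrow> bool" where
  "quotients_isomorphic E k F lam \<longleftrightarrow>
     (\<forall>j\<in>{1..k}. lmodule_isomorphic Atilde (graded_piece E F j) (E_rank1 (lam j)))"

definition semi_simple :: "(ab_series, 'm) module \<Rightarrow> bool" where
  "semi_simple E \<longleftrightarrow> ab_regular E \<and>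
     (\<exists>n (M :: nat \<Rightarrow> coord_module) N.
        (\<forall>i<n. ab_regular (M i) \<and> ab_module_of_rank 1 (M i)) \<and>
        submodule N Atilde (direct_sum_module n M) \<and>
        lmodule_isomorphic Atilde E (restrict_module (direct_sum_module n M) N))"

definition twisted_permutation :: "nat \<Rightarrow> (nat \<Rightarrow> complex) \<Rightarrow> (nat \<Rightarrow> complex) \<Rightarrow> bool" where
  "twisted_permutation k mu lam \<longleftrightarrow> (\<exists>\<sigma>. \<sigma> permutes {1..k} \<and>
     (\<forall>j\<in>{1..k}. mu j + of_nat j = lam (\<sigma> j) + of_nat (\<sigma> j)))"

end

theory Submission
  imports Defs
begin

text \<open>
  It suffices to exchange two consecutive quotients \<open>E\<^sub>\<alpha>, E\<^sub>\<beta>\<close> into \<open>E\<^sub>\<beta>\<^sub>+\<^sub>1, E\<^sub>\<alpha>\<^sub>-\<^sub>1\<close>, since in terms of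
  \<open>\<lambda>\<^sub>j + j\<close> this is an adjacent transposition. Let \<open>e, e'\<close> be a basis of the rank 2 subquotient with
  \<open>a e = \<alpha> b e\<close> and \<open>a e' = \<beta> b e' + f(b) e\<close>. The vector \<open>h(b) e + b e'\<close> is an eigenvector for \<open>\<beta> + 1\<close> iff
  \<open>f = (\<beta> + 1 - \<alpha>) h - b h'\<close>; this is solvable unless \<open>\<beta> + 1 - \<alpha>\<close> is a natural number \<open>n\<close> with
  \<open>f\<^sub>n \<noteq> 0\<close>, and if moreover \<open>f\<^sub>0 \<noteq> 0\<close>, then \<open>h\<close> is a unit and the line of the eigenvector has quotient
  \<open>E\<^sub>\<alpha>\<^sub>-\<^sub>1\<close>. Now \<open>f\<^sub>0 \<noteq> 0\<close> because all terms of the flag have a single generator: if \<open>g\<close>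
  generates \<open>F\<^sub>j\<^sub>+\<^sub>1\<close> and is normalised modulo \<open>F\<^sub>j\<close>, division by \<open>a - \<lambda> b\<close> shows that \<open>(a - \<lambda> b) g\<close> generates
  \<open>F\<^sub>j\<close>. And \<open>f\<^sub>n = 0\<close> because semi-simplicity provides enough morphisms from \<open>E\<close> to rank 1
  modules, of which some vanishes on a given \<open>F\<^sub>j\<close> but not on \<open>F\<^sub>j\<^sub>+\<^sub>1\<close>.
\<close>

section \<open>Computations in the algebra\<close>

lemma Atilde_simps [simp]:
  "carrier Atilde = UNIV" "u \<otimes>\<^bsub>Atilde\<^esub> v = ab_mult u v" "u \<oplus>\<^bsub>Atilde\<^esub> v = u + v"
  "\<one>\<^bsub>Atilde\<^esub> = 1" "\<zero>\<^bsub>Atilde\<^esub> = 0"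
  by (simp_all add: Atilde_def)

section \<open>Series in b inside the algebra, and their products with a\<close>

lemma fps_nth_ab_of_b [simp]: "fps_nth (ab_of_b f) n = [:fps_nth f n:]"
  by (simp add: ab_of_b_def)

lemma ab_of_b_add: "ab_of_b (f + g) = ab_of_b f + ab_of_b g"
  by (rule fps_ext) simp

lemma ab_of_b_0 [simp]: "ab_of_b 0 = 0"
  by (rule fps_ext) simp

lemma ab_of_b_1 [simp]: "ab_of_b 1 = 1"
  by (rule fps_ext) (simp add: one_pCons)

lemma ab_of_b_uminus: "ab_of_b (- f) = - ab_of_b f"
  by (rule fps_ext) simp

lemma ab_of_b_X: "ab_of_b fps_X = ab_b"
  by (rule fps_ext) (simp add: ab_b_def one_pCons fps_X_def)

lemma ab_of_b_const: "ab_of_b (fps_const c) = ab_scalar c"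
  by (rule fps_ext) (simp add: ab_scalar_def)

lemma higher_pderiv_const: "(pderiv ^^ k) [:c:] = (if k = 0 then [:c:] else 0)"
  by (cases k) (simp_all add: funpow_Suc_right del: funpow.simps)

text \<open>The coefficients of \<open>ab_of_b g\<close> are constants, so all terms of
  \<open>ab_mult\<close> with a derivative vanish and the commutative product remains.\<close>

lemma ab_mult_of_b_right: "ab_mult u (ab_of_b g) = u * ab_of_b g"
proof (rule fps_ext)
  fix n
  have "fps_nth (ab_mult u (ab_of_b g)) n = (\<Sum>i\<le>n. fps_nth u i * [:fps_nth g (n - i):])"
    unfolding ab_mult_def fps_nth_Abs_fps
  proof (rule sum.cong[OF refl])
    fix i
    show "(\<Sum>k\<le>n - i. fps_nth u i * Polynomial.smult (- of_nat i gchoose k)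
        ((pderiv ^^ k) (fps_nth (ab_of_b g) (n - i - k)))) = fps_nth u i * [:fps_nth g (n - i):]"
      by (subst sum.mono_neutral_right[of _ "{0}"]) (auto simp: higher_pderiv_const)
  qed
  then show "fps_nth (ab_mult u (ab_of_b g)) n = fps_nth (u * ab_of_b g) n"
    by (simp add: fps_mult_nth atLeast0AtMost)
qed

lemma sum_pCons_const: "(\<Sum>i\<in>A. [:c i:]) = [:\<Sum>i\<in>A. c i:]"
  by (induction A rule: infinite_finite_induct) auto

lemma ab_of_b_mult: "ab_mult (ab_of_b f) (ab_of_b g) = ab_of_b (f * g)"
  unfolding ab_mult_of_b_right
  by (rule fps_ext) (simp add: fps_mult_nth sum_pCons_const mult.commute)

text \<open>As \<open>ab_del ab_a = 1\<close>, the expansion of the product in powers of the two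
  derivations stops after k = 1.\<close>

lemma ab_mult_a_right: "ab_mult u ab_a = u * ab_a - ab_delta u"
proof (rule fps_ext)
  fix n
  have *: "ab_coef k * ((ab_delta ^^ k) u * (ab_del ^^ k) ab_a) =
      (if k = 0 then u * ab_a else if k = 1 then - ab_delta u else 0)" for k
  proof -
    have 0: "ab_del ab_a = 1"
      by (rule fps_ext) (simp add: ab_del_def ab_a_def pderiv_pCons)
    have 1: "(ab_del ^^ Suc l) ab_a = (if l = 0 then 1 else 0)" for l
      by (rule fps_ext) (simp add: 0 ab_del_pow_nth higher_pderiv_1 funpow_Suc_right del: funpow.simps)
    have 2: "fps_const [:- 1:] = (- 1 :: ab_series)"
      by (rule fps_ext) (simp add: one_pCons)
    show ?thesis
    proof (cases k)
      case 0
      then show ?thesis by (simp add: ab_coef_def ab_scalar_def one_pCons[symmetric])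
    next
      case (Suc l)
      then show ?thesis
        using 1[of l] by (auto simp: ab_coef_def ab_scalar_def 0 2)
    qed
  qed
  \<comment> \<open>The bound is \<open>Suc n\<close> and not \<open>n\<close>, so that the index 1
    lies in the range also for \<open>n = 0\<close>.\<close>
  have "fps_nth (ab_mult u ab_a) n = (\<Sum>k\<le>Suc n. fps_nth (ab_coef k * ((ab_delta ^^ k) u * (ab_del ^^ k) ab_a)) n)"
    by (rule ab_mult_nth_upto) simp
  also have "\<dots> = (\<Sum>k\<in>{0,1}. fps_nth (ab_coef k * ((ab_delta ^^ k) u * (ab_del ^^ k) ab_a)) n)"
    by (rule sum.mono_neutral_right) (auto simp: *)
  also have "\<dots> = fps_nth (u * ab_a - ab_delta u) n"
    unfolding * by simp
  finally show "fps_nth (ab_mult u ab_a) n = fps_nth (u * ab_a - ab_delta u) n" .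
qed

lemma ab_delta_of_b: "ab_delta (ab_of_b f) = ab_of_b (fps_X ^ 2 * fps_deriv f)"
proof (rule fps_ext)
  fix n
  have "fps_nth (fps_X ^ 2 * fps_deriv f) n = of_nat (n - 1) * fps_nth f (n - 1)"
    by (cases n; cases "n - 1") (auto simp: fps_X_power_mult_nth)
  then show "fps_nth (ab_delta (ab_of_b f)) n = fps_nth (ab_of_b (fps_X ^ 2 * fps_deriv f)) n"
    by (simp add: ab_delta_nth of_nat_poly)
qed

text \<open>The commutator of a with a series in b is the derivation b^2 d/db; the differential
  equations below all come from this rule.\<close>

lemma ab_a_of_b:
  "ab_mult ab_a (ab_of_b f) = ab_mult (ab_of_b f) ab_a + ab_of_b (fps_X ^ 2 * fps_deriv f)"
  by (simp add: ab_mult_of_b_right ab_mult_a_right ab_delta_of_b)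

text \<open>For a polynomial P with derivative P', one has P(a) b = b (P(a) + P'(a) b). Hence a
  factor b on the right can always be moved to the left.\<close>

lemma ab_mult_b_shift: "ab_mult u ab_b = ab_mult ab_b (u + ab_b * ab_del u)"
proof (rule fps_ext)
  fix n
  let ?t = "\<lambda>k. (-1 :: complex) ^ k"
  have m1: "(- 1 :: complex) gchoose k = ?t k" for k
    by (simp add: gbinomial_minus[of 1, simplified] gbinomial_pochhammer pochhammer_fact[symmetric])
  show "fps_nth (ab_mult u ab_b) n = fps_nth (ab_mult ab_b (u + ab_b * ab_del u)) n"
  proof (cases n)
    case 0
    then show ?thesis
      using ab_mult_b_power_right[of u 1] by (simp add: ab_mult_def ab_b_def)
  next
    case (Suc m)
    let ?d = "\<lambda>k. (pderiv ^^ k) (fps_nth u (m - k))"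
    let ?s = "\<lambda>k. Polynomial.smult (?t k) (?d k)"
    have "fps_nth (ab_mult ab_b (u + ab_b * ab_del u)) n =
        (\<Sum>k\<le>m. Polynomial.smult (?t k) ((pderiv ^^ k) (fps_nth (u + ab_b * ab_del u) (m - k))))"
      unfolding ab_mult_def fps_nth_Abs_fps
      by (subst sum.mono_neutral_right[of _ "{1}"]) (auto simp: ab_b_def Suc m1)
    \<comment> \<open>The sum telescopes: each term is \<open>?s k\<close> minus
      \<open>?s (Suc k)\<close>, and \<open>?s 0\<close> is the wanted coefficient of u.\<close>
    also have "\<dots> = (\<Sum>k\<le>m. ?s k - (if k < m then ?s (Suc k) else 0))"
    proof (rule sum.cong[OF refl])
      fix k assume "k \<in> {..m}"
      show "Polynomial.smult (?t k) ((pderiv ^^ k) (fps_nth (u + ab_b * ab_del u) (m - k))) =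
          ?s k - (if k < m then ?s (Suc k) else 0)"
      proof (cases "k < m")
        case True
        then obtain p where p: "m - k = Suc p" "m - Suc k = p"
          by (metis Suc_diff_Suc)
        then show ?thesis
          using True by (simp add: ab_b_def ab_del_def higher_pderiv_add smult_add_right funpow_swap1)
      next
        case False
        with \<open>k \<in> {..m}\<close> show ?thesis by (simp add: ab_b_def)
      qed
    qed
    also have "\<dots> = (\<Sum>k\<le>m. ?s k) - (\<Sum>k<m. ?s (Suc k))"
      unfolding sum_subtractf by (simp add: sum.If_cases Int_absorb1 lessThan_def[symmetric] subset_iff)
    also have "\<dots> = fps_nth u m"
      by (simp add: sum.atMost_shift)
    also have "\<dots> = fps_nth (ab_mult u ab_b) n"
      using ab_mult_b_power_right[of u 1] by (simp add: ab_b_def Suc)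
    finally show ?thesis by simp
  qed
qed

lemma ab_series_split: "\<exists>P v. u = fps_const P + ab_mult ab_b v"
proof -
  have "u = fps_const (fps_nth u 0) + fps_shift 1 u * ab_b"
    by (rule fps_ext) (auto simp: ab_b_def)
  then have "u = fps_const (fps_nth u 0) + ab_mult (fps_shift 1 u) ab_b"
    using ab_mult_b_power_right[of _ 1] by simp
  then show ?thesis
    unfolding ab_mult_b_shift by blast
qed

section \<open>Division with remainder by a - \<mu> b\<close>

lemma ab_mult_root_nth:
  "fps_nth (ab_mult w (ab_a - ab_mult (ab_scalar \<mu>) ab_b)) n = [:0, 1:] * fps_nth w n -
     (if n = 0 then 0 else Polynomial.smult (of_nat (n - 1) + \<mu>) (fps_nth w (n - 1)))"
proof -
  have "ab_mult (ab_scalar \<mu>) ab_b = ab_of_b (fps_const \<mu> * fps_X)"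
    by (simp add: ab_of_b_mult flip: ab_of_b_X ab_of_b_const)
  moreover have "ab_mult w (x - y) = ab_mult w x - ab_mult w y" for x y
    using ab_mult_add_right[of w "x - y" y] by simp
  moreover have "of_nat m * p = Polynomial.smult (of_nat m) p" for m and p :: "complex poly"
    by (simp add: of_nat_poly)
  moreover have "fps_nth (w * ab_of_b (fps_const \<mu> * fps_X)) n =
      (if n = 0 then 0 else Polynomial.smult \<mu> (fps_nth w (n - 1)))"
  proof -
    have "ab_of_b (fps_const \<mu> * fps_X) = fps_const [:\<mu>:] * fps_X"
      by (rule fps_ext) (simp add: fps_X_def)
    then show ?thesis
      by (simp add: mult.assoc[symmetric] mult.commute[of w])
  qed
  moreover have "fps_nth (w * ab_a) n = [:0, 1:] * fps_nth w n"
    by (simp add: ab_a_def mult.commute)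
  ultimately show ?thesis
    by (simp add: ab_mult_a_right ab_mult_of_b_right ab_delta_nth smult_add_left)
qed

text \<open>At each index the polynomial coefficient is divided by x: the constant term goes to the
  remainder f, the quotient to w. Right multiplication by \<mu> b and the commutator with a only
  affect higher indices, so this is a recursion.\<close>

lemma ab_division: "\<exists>w f. u = ab_mult w (ab_a - ab_mult (ab_scalar \<mu>) ab_b) + ab_of_b f"
proof -
  have "\<exists>c q. p = [:c:] + [:0, 1:] * q" for p :: "complex poly"
    by (cases p) (auto intro!: exI)
  then obtain c q where cq: "\<And>p :: complex poly. p = [:c p:] + [:0, 1:] * q p"
    by metis
  \<comment> \<open>The quotient at index n is carried to index n + 1 with the factor n +
    \<mu>.\<close>
  define Q where "Q = rec_nat (q (fps_nth u 0))
    (\<lambda>n r. q (fps_nth u (Suc n) + Polynomial.smult (of_nat n + \<mu>) r))"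
  define p where "p n = fps_nth u n +
    (if n = 0 then 0 else Polynomial.smult (of_nat (n - 1) + \<mu>) (Q (n - 1)))" for n
  have Q: "Q n = q (p n)" for n
    by (cases n) (auto simp: Q_def p_def)
  have "u = ab_mult (Abs_fps Q) (ab_a - ab_mult (ab_scalar \<mu>) ab_b) + ab_of_b (Abs_fps (\<lambda>n. c (p n)))"
  proof (rule fps_ext)
    fix n
    have "p n = [:c (p n):] + [:0, 1:] * Q n"
      unfolding Q by (rule cq)
    then have "fps_nth u n = [:c (p n):] + [:0, 1:] * Q n -
        (if n = 0 then 0 else Polynomial.smult (of_nat (n - 1) + \<mu>) (Q (n - 1)))"
      unfolding p_def by (simp add: algebra_simps)
    then show "fps_nth u n = fps_nth (ab_mult (Abs_fps Q) (ab_a - ab_mult (ab_scalar \<mu>) ab_b) +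
        ab_of_b (Abs_fps (\<lambda>n. c (p n)))) n"
      unfolding fps_add_nth ab_mult_root_nth by simp
  qed
  then show ?thesis by blast
qed

text \<open>Uniqueness of the remainder. If the preceding coefficient of w is zero, a constant
  equals x times the next one, which forces both to vanish.\<close>

lemma ab_of_b_eq_mult_root:
  assumes "ab_of_b f = ab_mult w (ab_a - ab_mult (ab_scalar \<mu>) ab_b)"
  shows "f = 0"
proof -
  have *: "[:fps_nth f n:] = [:0, 1:] * fps_nth w n -
     (if n = 0 then 0 else Polynomial.smult (of_nat (n - 1) + \<mu>) (fps_nth w (n - 1)))" for n
    using arg_cong[OF assms, of "\<lambda>u. fps_nth u n"] unfolding ab_mult_root_nth by simp
  have w: "fps_nth w n = 0" for n
  proof (induction n)
    case 0
    then show ?case using *[of 0] by simp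
  next
    case (Suc n)
    then show ?case using *[of "Suc n"] by simp
  qed
  show ?thesis
  proof (rule fps_ext)
    fix n
    show "fps_nth f n = fps_nth 0 n"
      using *[of n] by (cases n) (auto simp: w)
  qed
qed

section \<open>Modules and their functionals\<close>

locale ab_left_module = left_module Atilde M for M :: "(ab_series, 'm) module" (structure)
begin

abbreviation b_smult :: "complex fps \<Rightarrow> 'm \<Rightarrow> 'm" (infixr "\<star>" 70) where
  "f \<star> x \<equiv> ab_of_b f \<odot>\<^bsub>M\<^esub> x"

lemma ab_smult_closed [simp, intro]: "x \<in> carrier M \<Longrightarrow> u \<odot>\<^bsub>M\<^esub> x \<in> carrier M"
  by simp

lemma ab_smult_add_left: "x \<in> carrier M \<Longrightarrow> (u + v) \<odot>\<^bsub>M\<^esub> x = u \<odot>\<^bsub>M\<^esub> x \<oplus>\<^bsub>M\<^esub> v \<odot>\<^bsub>M\<^esub> x"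
  using smult_l_distr[of u v x] by simp

lemma ab_smult_add_right:
  "\<lbrakk>x \<in> carrier M; y \<in> carrier M\<rbrakk> \<Longrightarrow> u \<odot>\<^bsub>M\<^esub> (x \<oplus>\<^bsub>M\<^esub> y) = u \<odot>\<^bsub>M\<^esub> x \<oplus>\<^bsub>M\<^esub> u \<odot>\<^bsub>M\<^esub> y"
  by (simp add: smult_r_distr)

lemma ab_smult_smult: "x \<in> carrier M \<Longrightarrow> u \<odot>\<^bsub>M\<^esub> (v \<odot>\<^bsub>M\<^esub> x) = ab_mult u v \<odot>\<^bsub>M\<^esub> x"
  using smult_assoc1[of u v x] by simp

lemma ab_smult_one [simp]: "x \<in> carrier M \<Longrightarrow> 1 \<odot>\<^bsub>M\<^esub> x = x"
  using smult_one by simp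

lemma ab_smult_zero_left [simp]: "x \<in> carrier M \<Longrightarrow> 0 \<odot>\<^bsub>M\<^esub> x = \<zero>\<^bsub>M\<^esub>"
  using ab_smult_add_left[of x 0 0] by (simp add: M.add.l_cancel_one)

lemma ab_smult_zero_right [simp]: "u \<odot>\<^bsub>M\<^esub> \<zero>\<^bsub>M\<^esub> = \<zero>\<^bsub>M\<^esub>"
  using ab_smult_add_right[of "\<zero>\<^bsub>M\<^esub>" "\<zero>\<^bsub>M\<^esub>" u] by (simp add: M.add.l_cancel_one)

lemma ab_smult_minus_left: "x \<in> carrier M \<Longrightarrow> (- u) \<odot>\<^bsub>M\<^esub> x = \<ominus>\<^bsub>M\<^esub> (u \<odot>\<^bsub>M\<^esub> x)"
  using ab_smult_add_left[of x "- u" u] by (intro M.minus_equality[symmetric]) auto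

lemma ab_smult_minus_right: "x \<in> carrier M \<Longrightarrow> u \<odot>\<^bsub>M\<^esub> (\<ominus>\<^bsub>M\<^esub> x) = \<ominus>\<^bsub>M\<^esub> (u \<odot>\<^bsub>M\<^esub> x)"
  using ab_smult_add_right[of "\<ominus>\<^bsub>M\<^esub> x" x u]
  by (intro M.minus_equality[symmetric]) (auto simp: M.l_neg)

lemma b_smult_smult: "x \<in> carrier M \<Longrightarrow> f \<star> g \<star> x = (f * g) \<star> x"
  by (simp add: ab_smult_smult ab_of_b_mult)

lemma a_b_smult:
  "x \<in> carrier M \<Longrightarrow>
    ab_a \<odot>\<^bsub>M\<^esub> (f \<star> x) = f \<star> ab_a \<odot>\<^bsub>M\<^esub> x \<oplus>\<^bsub>M\<^esub> (fps_X ^ 2 * fps_deriv f) \<star> x"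
  by (simp add: ab_smult_smult ab_smult_add_left ab_a_of_b)

lemmas ab_smult_minus = ab_smult_minus_left ab_smult_minus_right

lemma restrict_left_module:
  assumes "submodule B Atilde M"
  shows "ab_left_module (restrict_module M B)"
proof -
  interpret B: submodule B Atilde M by fact
  have sub: "x \<in> B \<Longrightarrow> x \<in> carrier M" for x
    using B.subset by auto
  have inv: "\<ominus>\<^bsub>M\<^esub> x \<in> B" if "x \<in> B" for x
    using B.m_inv_closed that by (simp add: a_inv_def)
  have ab: "abelian_group (restrict_module M B)"
  proof (rule abelian_groupI)
    fix x assume "x \<in> carrier (restrict_module M B)"
    then show "\<exists>y\<in>carrier (restrict_module M B). y \<oplus>\<^bsub>restrict_module M B\<^esub> x = \<zero>\<^bsub>restrict_module M B\<^esub>"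
      by (intro bexI[of _ "\<ominus>\<^bsub>M\<^esub> x"]) (auto simp: restrict_module_def M.l_neg sub inv)
  qed (use B.m_closed B.one_closed in \<open>auto simp: restrict_module_def sub M.a_ac\<close>)
  show ?thesis
    unfolding ab_left_module_def left_module_def left_module_axioms_def
    using ring_Atilde ab
    by (auto simp: restrict_module_def sub ab_smult_add_left ab_smult_add_right ab_smult_smult)
qed

end

lemma restrict_module_simps [simp]:
  "carrier (restrict_module M B) = B" "x \<oplus>\<^bsub>restrict_module M B\<^esub> y = x \<oplus>\<^bsub>M\<^esub> y"
  "u \<odot>\<^bsub>restrict_module M B\<^esub> x = u \<odot>\<^bsub>M\<^esub> x" "\<zero>\<^bsub>restrict_module M B\<^esub> = \<zero>\<^bsub>M\<^esub>"
  by (simp_all add: restrict_module_def)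

text \<open>Morphisms to the module \<open>\<complex>[[b]]\<close> on which \<open>a\<close> acts as \<open>b\<^sup>2 d/db + h\<close>; for \<open>h = \<mu> b\<close> this is \<open>E\<^sub>\<mu>\<close>.
  General \<open>h\<close> spares the proof that regular modules of rank 1 have \<open>h\<close> divisible by \<open>b\<close>.\<close>

definition ab_functional :: "(ab_series, 'm) module \<Rightarrow> complex fps \<Rightarrow> ('m \<Rightarrow> complex fps) \<Rightarrow> bool" where
  "ab_functional M h p \<longleftrightarrow>
     (\<forall>x\<in>carrier M. \<forall>y\<in>carrier M. p (x \<oplus>\<^bsub>M\<^esub> y) = p x + p y) \<and>
     (\<forall>f. \<forall>x\<in>carrier M. p (ab_of_b f \<odot>\<^bsub>M\<^esub> x) = f * p x) \<and>
     (\<forall>x\<in>carrier M. p (ab_a \<odot>\<^bsub>M\<^esub> x) = fps_X ^ 2 * fps_deriv (p x) + h * p x)"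

lemma ab_functionalD:
  assumes "ab_functional M h p" "x \<in> carrier M"
  shows "y \<in> carrier M \<Longrightarrow> p (x \<oplus>\<^bsub>M\<^esub> y) = p x + p y"
    and "p (ab_of_b f \<odot>\<^bsub>M\<^esub> x) = f * p x"
    and "p (ab_a \<odot>\<^bsub>M\<^esub> x) = fps_X ^ 2 * fps_deriv (p x) + h * p x"
  using assms by (auto simp: ab_functional_def)

context ab_left_module
begin

lemma functional_zero: "ab_functional M h p \<Longrightarrow> p \<zero>\<^bsub>M\<^esub> = 0"
  using ab_functionalD(2)[of M h p "\<zero>\<^bsub>M\<^esub>" 0] by simp

lemma functional_minus:
  assumes "ab_functional M h p" "x \<in> carrier M"
  shows "p (\<ominus>\<^bsub>M\<^esub> x) = - p x"
  using ab_functionalD(2)[OF assms, of "- 1"] assms(2)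
  by (simp add: ab_of_b_uminus ab_smult_minus)

lemma functional_diff:
  assumes "ab_functional M h p" "x \<in> carrier M" "y \<in> carrier M"
  shows "p (x \<ominus>\<^bsub>M\<^esub> y) = p x - p y"
  using assms by (simp add: M.minus_eq ab_functionalD functional_minus)

end

lemma fps_X_powers_dvd_imp_0:
  fixes d :: "complex fps"
  assumes "\<And>n. fps_X ^ n dvd d"
  shows "d = 0"
proof (rule fps_ext)
  fix n
  obtain c where "d = fps_X ^ Suc n * c"
    using assms[of "Suc n"] by blast
  then show "fps_nth d n = fps_nth 0 n"
    by (simp add: fps_X_power_mult_nth del: power_Suc)
qed

text \<open>Modulo \<open>b\<^sup>n\<close> the action of a series only involves finitely many \<open>P\<^sub>\<nu>(a)\<close>; so the action on
  the values of \<open>p\<close> is determined by that of \<open>a\<close> although no continuity is assumed.\<close>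

lemma ab_functional_smult_cong:
  assumes "ab_left_module M" "ab_left_module N"
    and p: "ab_functional M h p" and q: "ab_functional N h q"
    and "x \<in> carrier M" "y \<in> carrier N" "p x = q y"
  shows "p (u \<odot>\<^bsub>M\<^esub> x) = q (u \<odot>\<^bsub>N\<^esub> y)"
proof -
  interpret M: ab_left_module M by fact
  interpret N: ab_left_module N by fact
  have poly: "p (fps_const P \<odot>\<^bsub>M\<^esub> x) = q (fps_const P \<odot>\<^bsub>N\<^esub> y)" for P
  proof (induction P)
    case 0
    then show ?case
      using assms(5,6) by (simp add: M.functional_zero[OF p] N.functional_zero[OF q])
  next
    case (pCons c P)
    have "fps_const (pCons c P) = ab_of_b (fps_const c) + ab_mult ab_a (fps_const P)"
      by (simp add: ab_of_b_const ab_scalar_def ab_a_def ab_mult_const_left)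
    then show ?case
      using assms(5-) pCons.IH
      by (simp add: M.ab_smult_add_left N.ab_smult_add_left ab_functionalD[OF p] ab_functionalD[OF q]
          flip: M.ab_smult_smult N.ab_smult_smult)
  qed
  \<comment> \<open>Writing u = P(a) + b v, the polynomial parts agree and the difference for u is b
    times the difference for v, which gains one factor b.\<close>
  have "fps_X ^ n dvd p (u \<odot>\<^bsub>M\<^esub> x) - q (u \<odot>\<^bsub>N\<^esub> y)" for n
  proof (induction n arbitrary: u)
    case (Suc n)
    obtain P v where u: "u = fps_const P + ab_mult (ab_of_b fps_X) v"
      using ab_series_split[of u] by (auto simp: ab_of_b_X)
    have "p (u \<odot>\<^bsub>M\<^esub> x) - q (u \<odot>\<^bsub>N\<^esub> y) = fps_X * (p (v \<odot>\<^bsub>M\<^esub> x) - q (v \<odot>\<^bsub>N\<^esub> y))"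
      using assms(5-) poly[of P] unfolding u
      by (simp add: M.ab_smult_add_left N.ab_smult_add_left ab_functionalD[OF p] ab_functionalD[OF q]
          right_diff_distrib flip: M.ab_smult_smult N.ab_smult_smult)
    then show ?case
      using Suc.IH[of v] by (simp add: mult_dvd_mono)
  qed simp
  then have "p (u \<odot>\<^bsub>M\<^esub> x) - q (u \<odot>\<^bsub>N\<^esub> y) = 0"
    by (rule fps_X_powers_dvd_imp_0)
  then show ?thesis by simp
qed

section \<open>Submodules and kernels of functionals\<close>

lemma (in ab_left_module) submoduleI:
  assumes "B \<subseteq> carrier M" "\<zero>\<^bsub>M\<^esub> \<in> B" "\<And>x y. x \<in> B \<Longrightarrow> y \<in> B \<Longrightarrow> x \<oplus>\<^bsub>M\<^esub> y \<in> B"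
    and "\<And>u x. x \<in> B \<Longrightarrow> u \<odot>\<^bsub>M\<^esub> x \<in> B"
  shows "submodule B Atilde M"
proof (intro submodule.intro submodule_axioms.intro)
  have "\<ominus>\<^bsub>M\<^esub> x \<in> B" if "x \<in> B" for x
    using assms(1) assms(4)[OF that, of "- 1"] that by (auto simp: ab_smult_minus)
  then show "subgroup B (add_monoid M)"
    by (intro subgroup.intro) (use assms in \<open>auto simp: a_inv_def\<close>)
qed (use assms in auto)

lemma (in ab_left_module) submoduleD:
  assumes "submodule B Atilde M"
  shows "B \<subseteq> carrier M" "\<zero>\<^bsub>M\<^esub> \<in> B" "\<And>x y. x \<in> B \<Longrightarrow> y \<in> B \<Longrightarrow> x \<oplus>\<^bsub>M\<^esub> y \<in> B"
    "\<And>x. x \<in> B \<Longrightarrow> \<ominus>\<^bsub>M\<^esub> x \<in> B" "\<And>x y. x \<in> B \<Longrightarrow> y \<in> B \<Longrightarrow> x \<ominus>\<^bsub>M\<^esub> y \<in> B"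
    "\<And>u x. x \<in> B \<Longrightarrow> u \<odot>\<^bsub>M\<^esub> x \<in> B"
proof -
  interpret B: submodule B Atilde M by fact
  show "B \<subseteq> carrier M" "\<zero>\<^bsub>M\<^esub> \<in> B" "\<And>x y. x \<in> B \<Longrightarrow> y \<in> B \<Longrightarrow> x \<oplus>\<^bsub>M\<^esub> y \<in> B"
    "\<And>u x. x \<in> B \<Longrightarrow> u \<odot>\<^bsub>M\<^esub> x \<in> B"
    using B.subset B.one_closed B.m_closed by auto
  show inv: "\<And>x. x \<in> B \<Longrightarrow> \<ominus>\<^bsub>M\<^esub> x \<in> B"
    using B.m_inv_closed by (simp add: a_inv_def)
  show "\<And>x y. x \<in> B \<Longrightarrow> y \<in> B \<Longrightarrow> x \<ominus>\<^bsub>M\<^esub> y \<in> B"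
    using inv B.m_closed by (simp add: M.minus_eq)
qed

text \<open>Stability under an arbitrary series u follows from
  \<open>ab_functional_smult_cong\<close>: if x has the same value as zero, then so have u x and u
  applied to zero.\<close>

lemma (in ab_left_module) kernel_submodule:
  assumes "submodule B Atilde M" "ab_functional (restrict_module M B) h p"
  shows "submodule {x \<in> B. p x = 0} Atilde M"
proof -
  note B = submoduleD[OF assms(1)]
  interpret B: ab_left_module "restrict_module M B"
    by (rule restrict_left_module) fact
  have p0: "p \<zero>\<^bsub>M\<^esub> = 0"
    using B.functional_zero[OF assms(2)] by simp
  have "p (u \<odot>\<^bsub>M\<^esub> x) = 0" if "x \<in> B" "p x = 0" for u x
    using ab_functional_smult_cong[OF B.ab_left_module_axioms B.ab_left_module_axioms assms(2,2),
        of x "\<zero>\<^bsub>M\<^esub>" u] B that p0 by simp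
  then show ?thesis
    using B p0 ab_functionalD(1)[OF assms(2)] by (intro submoduleI) auto
qed

section \<open>Quotient modules\<close>

context ab_left_module
begin

context
  fixes N
  assumes N: "submodule N Atilde M"
begin

lemma a_subgroup: "abelian_subgroup N M"
proof -
  interpret N: submodule N Atilde M by fact
  show ?thesis
    by (rule abelian_subgroupI3)
      (auto intro: additive_subgroup.intro N.subgroup_axioms M.abelian_group_axioms)
qed

lemma quot_left_module: "ab_left_module (quot_module M N)"
  unfolding ab_left_module_def by (rule quot_module_left_module[OF left_module_axioms N])

lemma quot_carrier: "carrier (quot_module M N) = (\<lambda>x. N +>\<^bsub>M\<^esub> x) ` carrier M"
  by (auto simp: quot_module_def A_RCOSETS_def')

lemma quot_add:
  "\<lbrakk>x \<in> carrier M; y \<in> carrier M\<rbrakk> \<Longrightarrow>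
    (N +>\<^bsub>M\<^esub> x) \<oplus>\<^bsub>quot_module M N\<^esub> (N +>\<^bsub>M\<^esub> y) = N +>\<^bsub>M\<^esub> (x \<oplus>\<^bsub>M\<^esub> y)"
  using abelian_subgroup.a_rcos_sum[OF a_subgroup] by (simp add: quot_module_def)

lemma quot_eq_iff:
  assumes "x \<in> carrier M" "y \<in> carrier M"
  shows "N +>\<^bsub>M\<^esub> x = N +>\<^bsub>M\<^esub> y \<longleftrightarrow> x \<ominus>\<^bsub>M\<^esub> y \<in> N"
proof
  interpret N: abelian_subgroup N M by (rule a_subgroup)
  assume "N +>\<^bsub>M\<^esub> x = N +>\<^bsub>M\<^esub> y"
  then have "x \<in> N +>\<^bsub>M\<^esub> y"
    using N.a_rcos_self[OF assms(1)] by simp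
  then obtain n where n: "n \<in> N" "x = n \<oplus>\<^bsub>M\<^esub> y"
    by (auto simp: a_r_coset_def')
  then have "x \<ominus>\<^bsub>M\<^esub> y = n"
    using assms N.a_Hcarr by (simp add: M.minus_eq M.a_assoc M.r_neg)
  then show "x \<ominus>\<^bsub>M\<^esub> y \<in> N"
    using n by simp
next
  interpret N: abelian_subgroup N M by (rule a_subgroup)
  assume *: "x \<ominus>\<^bsub>M\<^esub> y \<in> N"
  have "x = (x \<ominus>\<^bsub>M\<^esub> y) \<oplus>\<^bsub>M\<^esub> y"
    using assms by (simp add: M.minus_eq M.a_assoc M.l_neg)
  then have "x \<in> N +>\<^bsub>M\<^esub> y"
    using * by (auto simp: a_r_coset_def')
  then show "N +>\<^bsub>M\<^esub> x = N +>\<^bsub>M\<^esub> y"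
    by (rule N.a_repr_independence'[symmetric]) fact
qed

lemma quot_smult:
  assumes "x \<in> carrier M"
  shows "u \<odot>\<^bsub>quot_module M N\<^esub> (N +>\<^bsub>M\<^esub> x) = N +>\<^bsub>M\<^esub> (u \<odot>\<^bsub>M\<^esub> x)"
proof -
  interpret N: abelian_subgroup N M by (rule a_subgroup)
  have "N +>\<^bsub>M\<^esub> (u \<odot>\<^bsub>M\<^esub> y) = N +>\<^bsub>M\<^esub> (u \<odot>\<^bsub>M\<^esub> x)" if y: "y \<in> N +>\<^bsub>M\<^esub> x" for y
  proof -
    have yc: "y \<in> carrier M"
      using y assms N.a_Hcarr by (auto simp: a_r_coset_def')
    have "N +>\<^bsub>M\<^esub> x = N +>\<^bsub>M\<^esub> y"
      using y assms by (rule N.a_repr_independence')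
    then have "y \<ominus>\<^bsub>M\<^esub> x \<in> N"
      using quot_eq_iff[OF yc assms] by simp
    then have "u \<odot>\<^bsub>M\<^esub> (y \<ominus>\<^bsub>M\<^esub> x) \<in> N"
      by (rule submoduleD(6)[OF N])
    then show ?thesis
      using assms yc by (subst quot_eq_iff) (auto simp: M.minus_eq ab_smult_add_right ab_smult_minus)
  qed
  moreover have "x \<in> N +>\<^bsub>M\<^esub> x"
    using assms by (rule N.a_rcos_self)
  ultimately have "(\<Union>y\<in>N +>\<^bsub>M\<^esub> x. N +>\<^bsub>M\<^esub> (u \<odot>\<^bsub>M\<^esub> y)) = N +>\<^bsub>M\<^esub> (u \<odot>\<^bsub>M\<^esub> x)"
    by blast
  then show ?thesis
    by (simp add: quot_module_def)
qed

lemma functional_pullback: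
  assumes "ab_functional (quot_module M N) h p"
  shows "ab_functional M h (\<lambda>x. p (N +>\<^bsub>M\<^esub> x))"
  unfolding ab_functional_def
  by (auto simp: quot_carrier ab_functionalD[OF assms] simp flip: quot_add quot_smult)

end

text \<open>Two cosets of the kernel coincide exactly when the values of p do, so p descends to the
  quotient and becomes injective there.\<close>

lemma functional_quot:
  assumes "ab_functional M h p" "N = {x \<in> carrier M. p x = 0}"
  shows "\<exists>q. ab_functional (quot_module M N) h q \<and> (\<forall>x\<in>carrier M. q (N +>\<^bsub>M\<^esub> x) = p x) \<and>
    inj_on q (carrier (quot_module M N))"
proof -
  have rM: "restrict_module M (carrier M) = M"
    by (simp add: restrict_module_def)
  have "submodule (carrier M) Atilde M"
    by (rule submoduleI) auto
  then have N: "submodule N Atilde M"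
    unfolding assms(2) by (rule kernel_submodule) (use assms(1) rM in simp)
  have eq: "N +>\<^bsub>M\<^esub> x = N +>\<^bsub>M\<^esub> y \<longleftrightarrow> p x = p y" if "x \<in> carrier M" "y \<in> carrier M" for x y
    unfolding quot_eq_iff[OF N that] using that by (simp add: assms(2) functional_diff[OF assms(1)])
  define q where "q X = (THE c. \<exists>x\<in>carrier M. X = N +>\<^bsub>M\<^esub> x \<and> c = p x)" for X
  have q: "q (N +>\<^bsub>M\<^esub> x) = p x" if "x \<in> carrier M" for x
    unfolding q_def by (rule the_equality) (use that eq in auto)
  have "ab_functional (quot_module M N) h q"
    unfolding ab_functional_def
    by (auto simp: quot_carrier[OF N] quot_add[OF N] quot_smult[OF N] q ab_functionalD[OF assms(1)])
  moreover have "inj_on q (carrier (quot_module M N))"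
    by (auto simp: inj_on_def quot_carrier[OF N] q eq)
  ultimately show ?thesis
    using q by blast
qed

end

section \<open>Quotients of rank 1\<close>

lemma functional_comp:
  assumes "ab_functional N h p" "g \<in> lmodule_hom Atilde M N"
  shows "ab_functional M h (\<lambda>x. p (g x))"
  using assms by (auto simp: ab_functional_def lmodule_hom_def Pi_iff)

text \<open>Both modules are identified with the same twisted module of power series. The composite
  of p with the inverse of q is linear over all series by
  \<open>ab_functional_smult_cong\<close>.\<close>

lemma isomorphic_if_functionals:
  assumes "ab_left_module M" "ab_left_module N"
    and p: "ab_functional M h p" "bij_betw p (carrier M) UNIV"
    and q: "ab_functional N h q" "bij_betw q (carrier N) UNIV"
  shows "lmodule_isomorphic Atilde M N"
proof -
  interpret M: ab_left_module M by fact
  interpret N: ab_left_module N by fact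
  define g where "g x = inv_into (carrier N) q (p x)" for x
  have g: "g x \<in> carrier N" "q (g x) = p x" for x
    using q(2) unfolding g_def bij_betw_def by (auto intro: inv_into_into f_inv_into_f)
  have gI: "g x = y" if "y \<in> carrier N" "q y = p x" for x y
    using that g q(2) unfolding bij_betw_def by (metis inj_onD)
  have "g (x \<oplus>\<^bsub>M\<^esub> y) = g x \<oplus>\<^bsub>N\<^esub> g y" if "x \<in> carrier M" "y \<in> carrier M" for x y
    by (rule gI) (use that in \<open>auto simp: ab_functionalD[OF p(1)] ab_functionalD[OF q(1)] g\<close>)
  moreover have "g (u \<odot>\<^bsub>M\<^esub> x) = u \<odot>\<^bsub>N\<^esub> g x" if "x \<in> carrier M" for u x
    by (rule gI) (use that in \<open>auto simp: g ab_functional_smult_cong[OF assms(2,1) q(1) p(1)]\<close>)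
  moreover have "bij_betw g (carrier M) (carrier N)"
    unfolding g_def using bij_betw_trans[OF p(2) bij_betw_inv_into[OF q(2)]]
    by (simp add: comp_def)
  ultimately show ?thesis
    unfolding lmodule_isomorphic_def lmodule_hom_def using g by (intro bexI[of _ g]) auto
qed

lemma (in ab_left_module) is_b_basis_1:
  "is_b_basis M 1 e \<longleftrightarrow> e 0 \<in> carrier M \<and> (\<forall>x\<in>carrier M. \<exists>!f. x = f \<star> e 0)"
proof (cases "e 0 \<in> carrier M")
  case True
  have fin: "(\<Oplus>\<^bsub>M\<^esub>i\<in>{..<1}. ab_of_b (c i) \<odot>\<^bsub>M\<^esub> e i) = c 0 \<star> e 0" for c
    using True by (simp add: lessThan_Suc)
  have "(\<exists>!c. c \<in> {..<1::nat} \<rightarrow>\<^sub>E UNIV \<and> x = c 0 \<star> e 0) \<longleftrightarrow> (\<exists>!f. x = f \<star> e 0)" for x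
  proof
    assume "\<exists>!c. c \<in> {..<1::nat} \<rightarrow>\<^sub>E UNIV \<and> x = c 0 \<star> e 0"
    then obtain c where c: "x = c 0 \<star> e 0"
      "\<And>d. d \<in> {..<1::nat} \<rightarrow>\<^sub>E UNIV \<Longrightarrow> x = d 0 \<star> e 0 \<Longrightarrow> d = c"
      by auto
    have "f = c 0" if "x = f \<star> e 0" for f
      using c(2)[of "\<lambda>i\<in>{..<1}. f"] that by auto
    then show "\<exists>!f. x = f \<star> e 0"
      using c(1) by blast
  next
    assume "\<exists>!f. x = f \<star> e 0"
    then obtain f where f: "x = f \<star> e 0" "\<And>g. x = g \<star> e 0 \<Longrightarrow> g = f"
      by auto
    show "\<exists>!c. c \<in> {..<1::nat} \<rightarrow>\<^sub>E UNIV \<and> x = c 0 \<star> e 0"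
    proof (rule ex1I[of _ "\<lambda>i\<in>{..<1}. f"])
      fix d assume "d \<in> {..<1::nat} \<rightarrow>\<^sub>E UNIV \<and> x = d 0 \<star> e 0"
      then show "d = (\<lambda>i\<in>{..<1}. f)"
        using f(2) by (auto simp: fun_eq_iff PiE_def extensional_def)
    qed (use f in auto)
  qed
  then show ?thesis
    unfolding is_b_basis_def fin using True by (auto simp: Pi_iff)
qed (auto simp: is_b_basis_def)

text \<open>A preimage x1 of 1 is a basis, because x and \<open>p x \<star> x1\<close> have the same
  value under the injective p.\<close>

lemma rank_1_if_functional:
  assumes "ab_left_module M" "ab_functional M h p" "bij_betw p (carrier M) UNIV"
  shows "ab_module_of_rank 1 M"
proof -
  interpret ab_left_module M by fact
  obtain x1 where x1: "x1 \<in> carrier M" "p x1 = 1"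
    using assms(3) unfolding bij_betw_def by (metis UNIV_I imageE)
  have "\<exists>!f. x = f \<star> x1" if "x \<in> carrier M" for x
  proof (rule ex1I[of _ "p x"])
    show "x = p x \<star> x1"
      using assms(3) that x1 unfolding bij_betw_def
      by (intro inj_onD[of p "carrier M"]) (auto simp: ab_functionalD[OF assms(2)])
  qed (use x1 in \<open>auto simp: ab_functionalD[OF assms(2)]\<close>)
  then have "is_b_basis M 1 (\<lambda>_. x1)"
    using x1 by (simp only: is_b_basis_1) blast
  then show ?thesis
    unfolding ab_module_of_rank_def using left_module_axioms by blast
qed

text \<open>Here p is the coordinate along a basis vector x1 and h is the coordinate of a x1; the
  rule for a on f x1 is \<open>a_b_smult\<close>.\<close>

lemma functional_if_rank_1:
  assumes "ab_module_of_rank 1 M"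
  shows "\<exists>h p. ab_functional M h p \<and> inj_on p (carrier M)"
proof -
  interpret ab_left_module M
    using assms by (simp add: ab_module_of_rank_def ab_left_module_def)
  obtain e where "is_b_basis M 1 e"
    using assms unfolding ab_module_of_rank_def by blast
  then obtain x1 where x1: "x1 \<in> carrier M" "\<And>x. x \<in> carrier M \<Longrightarrow> \<exists>!f. x = f \<star> x1"
    unfolding is_b_basis_1 by meson
  define p where "p x = (THE f. x = f \<star> x1)" for x
  have p: "x = p x \<star> x1" if "x \<in> carrier M" for x
    unfolding p_def by (rule theI') (rule x1(2)[OF that])
  have pI: "p x = f" if "x = f \<star> x1" for x f
    unfolding p_def by (rule the1_equality) (use x1 that in auto)
  have "ab_functional M (p (ab_a \<odot>\<^bsub>M\<^esub> x1)) p"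
    unfolding ab_functional_def
  proof (intro conjI ballI allI)
    fix x y assume xy: "x \<in> carrier M" "y \<in> carrier M"
    show "p (x \<oplus>\<^bsub>M\<^esub> y) = p x + p y"
      by (rule pI) (use p[OF xy(1)] p[OF xy(2)] x1(1) in \<open>simp add: ab_of_b_add ab_smult_add_left\<close>)
  next
    fix f x assume x: "x \<in> carrier M"
    show "p (f \<star> x) = f * p x"
      by (rule pI) (use arg_cong[OF p[OF x], of "\<lambda>y. f \<star> y"] x1(1) in \<open>simp add: b_smult_smult\<close>)
  next
    fix x assume x: "x \<in> carrier M"
    let ?h = "p (ab_a \<odot>\<^bsub>M\<^esub> x1)"
    have "ab_a \<odot>\<^bsub>M\<^esub> x = ab_a \<odot>\<^bsub>M\<^esub> (p x \<star> x1)"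
      using p[OF x] by simp
    also have "\<dots> = p x \<star> ?h \<star> x1 \<oplus>\<^bsub>M\<^esub> (fps_X ^ 2 * fps_deriv (p x)) \<star> x1"
      using x1(1) p[of "ab_a \<odot>\<^bsub>M\<^esub> x1"] by (simp add: a_b_smult)
    also have "\<dots> = (fps_X ^ 2 * fps_deriv (p x) + ?h * p x) \<star> x1"
      using x1(1) by (simp add: b_smult_smult ab_of_b_add ab_smult_add_left M.a_comm mult.commute)
    finally show "p (ab_a \<odot>\<^bsub>M\<^esub> x) = fps_X ^ 2 * fps_deriv (p x) + ?h * p x"
      by (rule pI)
  qed
  moreover have "inj_on p (carrier M)"
    by (rule inj_onI) (metis p)
  ultimately show ?thesis by blast
qed

section \<open>The rank 1 modules \<open>E_rank1 \<mu>\<close> as twisted modules of power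
  series\<close>

abbreviation ab_weight :: "complex \<Rightarrow> complex fps" where
  "ab_weight \<mu> \<equiv> fps_const \<mu> * fps_X"

abbreviation root_ideal :: "complex \<Rightarrow> ab_series set" where
  "root_ideal \<mu> \<equiv> range (\<lambda>u. ab_mult u (ab_a - ab_mult (ab_scalar \<mu>) ab_b))"

lemma Atilde_left_module: "ab_left_module Atilde_module"
proof -
  interpret A: ring Atilde by (rule ring_Atilde)
  have "\<exists>y. y + x = 0" for x :: ab_series
    by (rule exI[of _ "- x"]) simp
  then have "abelian_group Atilde_module"
    by (intro abelian_groupI) (auto simp: Atilde_module_def algebra_simps)
  moreover have "ab_mult 1 x = x" for x
    using A.l_one[of x] by simp
  ultimately show ?thesis
    unfolding ab_left_module_def left_module_def left_module_axioms_def
    using ring_Atilde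
    by (auto simp: Atilde_module_def ab_mult_add_left ab_mult_add_right ab_mult_assoc)
qed

lemma ab_weight_of_b: "ab_mult (ab_scalar \<mu>) ab_b = ab_of_b (ab_weight \<mu>)"
  by (simp add: ab_of_b_mult flip: ab_of_b_X ab_of_b_const)

text \<open>The value of p at u is the remainder of u under division by a - \<mu> b. Its kernel is
  therefore the left ideal, and each series in b is its own remainder.\<close>

lemma Atilde_functional:
  "\<exists>p. ab_functional Atilde_module (ab_weight \<mu>) p \<and> {u. p u = 0} = root_ideal \<mu> \<and> surj p"
proof -
  let ?r = "ab_a - ab_mult (ab_scalar \<mu>) ab_b"
  let ?I = "root_ideal \<mu>"
  have diff: "ab_mult x (y - z) = ab_mult x y - ab_mult x z" for x y z
    using ab_mult_add_right[of x "y - z" z] by simp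
  have diff': "ab_mult (y - z) x = ab_mult y x - ab_mult z x" for x y z
    using ab_mult_add_left[of "y - z" z x] by simp
  have I_add: "x + y \<in> ?I" if xy: "x \<in> ?I" "y \<in> ?I" for x y
  proof -
    obtain u v where "x = ab_mult u ?r" "y = ab_mult v ?r"
      using xy by blast
    then have "x + y = ab_mult (u + v) ?r"
      by (simp add: ab_mult_add_left)
    then show ?thesis by blast
  qed
  have I_mult: "ab_mult u x \<in> ?I" if "x \<in> ?I" for u x
    using that by (auto simp flip: ab_mult_assoc)
  have I_0: "f = g" if fg: "u - ab_of_b f \<in> ?I" "u - ab_of_b g \<in> ?I" for u f g
  proof -
    obtain v w where vw: "u - ab_of_b f = ab_mult v ?r" "u - ab_of_b g = ab_mult w ?r"
      using fg by blast
    have "ab_of_b (f - g) = ab_of_b f - ab_of_b g"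
      using ab_of_b_add[of "f - g" g] by simp
    also have "\<dots> = ab_mult (w - v) ?r"
      using vw unfolding diff' by (simp add: algebra_simps)
    finally show ?thesis
      using ab_of_b_eq_mult_root by fastforce
  qed
  have "\<exists>f. u - ab_of_b f \<in> ?I" for u
    using ab_division[of u \<mu>] by (metis add_diff_cancel_right' rangeI)
  then obtain p where p: "\<And>u. u - ab_of_b (p u) \<in> ?I"
    by metis
  have pI: "p u = f" if "u - ab_of_b f \<in> ?I" for u f
    using I_0 p that by blast
  have "ab_functional Atilde_module (ab_weight \<mu>) p"
    unfolding ab_functional_def
  proof (intro conjI ballI allI)
    fix x y
    show "p (x \<oplus>\<^bsub>Atilde_module\<^esub> y) = p x + p y"
      using I_add[OF p[of x] p[of y]] by (intro pI) (simp add: Atilde_module_def ab_of_b_add algebra_simps)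
  next
    fix f x
    show "p (ab_of_b f \<odot>\<^bsub>Atilde_module\<^esub> x) = f * p x"
      using I_mult[OF p[of x], of "ab_of_b f"]
      by (intro pI) (simp add: Atilde_module_def diff ab_of_b_mult)
  next
    fix x
    let ?g = "fps_X ^ 2 * fps_deriv (p x) + ab_weight \<mu> * p x"
    \<comment> \<open>For f = p x one has f (a - \<mu> b) = a f - (b^2 f' + \<mu> b f), so modulo
      the left ideal a f becomes the twisted derivative of f.\<close>
    have "ab_mult (ab_of_b (p x)) ?r = ab_mult ab_a (ab_of_b (p x)) - ab_of_b ?g"
      by (simp add: diff ab_a_of_b ab_weight_of_b ab_of_b_mult ab_of_b_add mult.commute)
    moreover have "ab_mult ab_a (x - ab_of_b (p x)) + ab_mult (ab_of_b (p x)) ?r \<in> ?I"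
      by (rule I_add[OF I_mult[OF p]]) blast
    ultimately show "p (ab_a \<odot>\<^bsub>Atilde_module\<^esub> x) = ?g"
      by (intro pI) (simp add: Atilde_module_def diff)
  qed
  moreover have "p u = 0 \<longleftrightarrow> u \<in> ?I" for u
    using p[of u] pI[of u 0] by auto
  moreover have "surj p"
  proof (rule surjI)
    have "(0 :: ab_series) = ab_mult 0 ?r"
      using diff'[of 0 0 ?r] by simp
    then have "0 \<in> ?I" by blast
    then show "p (ab_of_b f) = f" for f
      by (intro pI) simp
  qed
  ultimately show ?thesis by blast
qed

lemma E_rank1_functional:
  "ab_left_module (E_rank1 \<mu>) \<and>
    (\<exists>p. ab_functional (E_rank1 \<mu>) (ab_weight \<mu>) p \<and> bij_betw p (carrier (E_rank1 \<mu>)) UNIV)"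
proof -
  interpret A: ab_left_module Atilde_module by (rule Atilde_left_module)
  obtain p where p: "ab_functional Atilde_module (ab_weight \<mu>) p" "{u. p u = 0} = root_ideal \<mu>" "surj p"
    using Atilde_functional by blast
  have I: "root_ideal \<mu> = {u \<in> carrier Atilde_module. p u = 0}"
    using p(2) by (simp add: Atilde_module_def)
  have "submodule (carrier Atilde_module) Atilde Atilde_module"
    by (rule A.submoduleI) auto
  then have sub: "submodule (root_ideal \<mu>) Atilde Atilde_module"
    unfolding I by (rule A.kernel_submodule) (use p(1) in \<open>simp add: restrict_module_def\<close>)
  obtain q where q: "ab_functional (E_rank1 \<mu>) (ab_weight \<mu>) q"
    "\<And>x. x \<in> carrier Atilde_module \<Longrightarrow> q (root_ideal \<mu> +>\<^bsub>Atilde_module\<^esub> x) = p x"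
    "inj_on q (carrier (E_rank1 \<mu>))"
    using A.functional_quot[OF p(1) I] unfolding E_rank1_def by blast
  have "q ` carrier (E_rank1 \<mu>) = p ` carrier Atilde_module"
    unfolding E_rank1_def A.quot_carrier[OF sub] using q(2) by (simp add: image_image)
  then have "bij_betw q (carrier (E_rank1 \<mu>)) UNIV"
    using p(3) q(3) by (simp add: bij_betw_def Atilde_module_def)
  then show ?thesis
    using q(1) A.quot_left_module[OF sub] unfolding E_rank1_def by blast
qed

text \<open>Records an isomorphism of B/A with \<open>E_rank1 \<mu>\<close> as a map on B with
  kernel A, namely the coordinate on the quotient, so that later arguments run on elements instead
  of cosets.\<close>

definition ab_quotient_map ::
  "(ab_series, 'm) module \<Rightarrow> 'm set \<Rightarrow> 'm set \<Rightarrow> complex \<Rightarrow> ('m \<Rightarrow> complex fps) \<Rightarrow> bool" where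
  "ab_quotient_map E A B \<mu> p \<longleftrightarrow>
     ab_functional (restrict_module E B) (ab_weight \<mu>) p \<and> {x \<in> B. p x = 0} = A \<and> p ` B = UNIV"

text \<open>From left to right, p is the projection followed by the isomorphism and the coordinate
  of \<open>E_rank1 \<mu>\<close>. Conversely p descends to a bijective functional on the quotient,
  of the same weight as that coordinate.\<close>

lemma (in ab_left_module) quotient_E_rank1_iff:
  assumes B: "submodule B Atilde M" and A: "submodule A Atilde M" "A \<subseteq> B"
  shows "(ab_module_of_rank 1 (quot_module (restrict_module M B) A) \<and>
      lmodule_isomorphic Atilde (quot_module (restrict_module M B) A) (E_rank1 \<mu>)) \<longleftrightarrow>
    (\<exists>p. ab_quotient_map M A B \<mu> p)" (is "?L \<longleftrightarrow> ?R")
proof -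
  let ?B = "restrict_module M B"
  let ?Q = "quot_module ?B A"
  interpret B: ab_left_module ?B
    by (rule restrict_left_module) fact
  have A': "submodule A Atilde ?B"
    using submoduleD[OF A(1)] A(2) by (intro B.submoduleI) auto
  obtain q where q: "ab_functional (E_rank1 \<mu>) (ab_weight \<mu>) q"
    "bij_betw q (carrier (E_rank1 \<mu>)) UNIV"
    using E_rank1_functional by blast
  show ?thesis
  proof
    assume ?L
    then obtain g where g: "g \<in> lmodule_hom Atilde ?Q (E_rank1 \<mu>)"
      "bij_betw g (carrier ?Q) (carrier (E_rank1 \<mu>))"
      unfolding lmodule_isomorphic_def by blast
    define r where "r X = q (g X)" for X
    have r: "ab_functional ?Q (ab_weight \<mu>) r"
      unfolding r_def by (rule functional_comp[OF q(1) g(1)])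
    have rbij: "bij_betw r (carrier ?Q) UNIV"
      using bij_betw_trans[OF g(2) q(2)] by (simp add: comp_def r_def[abs_def])
    define p where "p x = r (A +>\<^bsub>?B\<^esub> x)" for x
    have p: "ab_functional ?B (ab_weight \<mu>) p"
      unfolding p_def by (rule B.functional_pullback[OF A' r])
    have p0: "p x = 0 \<longleftrightarrow> x \<in> A" if "x \<in> B" for x
    proof -
      have zB: "\<zero>\<^bsub>M\<^esub> \<in> B"
        using submoduleD[OF B] by blast
      have "p \<zero>\<^bsub>M\<^esub> = 0"
        using B.functional_zero[OF p] by simp
      then have "p x = 0 \<longleftrightarrow> r (A +>\<^bsub>?B\<^esub> x) = r (A +>\<^bsub>?B\<^esub> \<zero>\<^bsub>?B\<^esub>)"
        by (simp add: p_def)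
      also have "\<dots> \<longleftrightarrow> A +>\<^bsub>?B\<^esub> x = A +>\<^bsub>?B\<^esub> \<zero>\<^bsub>?B\<^esub>"
        using rbij that zB unfolding bij_betw_def
        by (intro inj_on_eq_iff[of r "carrier ?Q"]) (auto simp: B.quot_carrier[OF A'])
      also have "\<dots> \<longleftrightarrow> x \<in> A"
      proof -
        have "\<ominus>\<^bsub>?B\<^esub> \<zero>\<^bsub>?B\<^esub> = \<zero>\<^bsub>?B\<^esub>"
          by (rule B.M.minus_equality) (use B.M.zero_closed B.M.r_zero in auto)
        then have "x \<ominus>\<^bsub>?B\<^esub> \<zero>\<^bsub>?B\<^esub> = x"
          unfolding B.M.minus_eq using B.M.r_zero[of x] that by simp
        then show ?thesis
          using that zB by (subst B.quot_eq_iff[OF A']) auto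
      qed
      finally show ?thesis .
    qed
    have "p ` B = r ` carrier ?Q"
      unfolding B.quot_carrier[OF A'] p_def by (simp add: image_image)
    then have "p ` B = UNIV"
      using rbij by (simp add: bij_betw_def)
    then have "ab_quotient_map M A B \<mu> p"
      unfolding ab_quotient_map_def using p p0 A(2) by blast
    then show ?R by blast
  next
    assume ?R
    then obtain p where p: "ab_functional ?B (ab_weight \<mu>) p" "A = {x \<in> carrier ?B. p x = 0}" "p ` B = UNIV"
      unfolding ab_quotient_map_def by auto
    obtain r where r: "ab_functional ?Q (ab_weight \<mu>) r"
      "\<And>x. x \<in> carrier ?B \<Longrightarrow> r (A +>\<^bsub>?B\<^esub> x) = p x" "inj_on r (carrier ?Q)"
      using B.functional_quot[OF p(1,2)] by blast
    have "r ` carrier ?Q = p ` B"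
      unfolding B.quot_carrier[OF A'] using r(2) by (simp add: image_image)
    then have rbij: "bij_betw r (carrier ?Q) UNIV"
      using r(3) p(3) by (simp add: bij_betw_def)
    show ?L
      using rank_1_if_functional[OF B.quot_left_module[OF A'] r(1) rbij]
        isomorphic_if_functionals[OF B.quot_left_module[OF A'] _ r(1) rbij q] E_rank1_functional
      by blast
  qed
qed

text \<open>Embed E in a direct sum of rank 1 modules and follow each component by an injective
  functional of the summand. If all of these vanish at x, then x and zero have the same
  image.\<close>

lemma semi_simple_functionals:
  assumes "semi_simple E" "ab_left_module E" "x \<in> carrier E" "x \<noteq> \<zero>\<^bsub>E\<^esub>"
  shows "\<exists>h p. ab_functional E h p \<and> p x \<noteq> 0"
proof (rule ccontr)
  assume none: "\<not> ?thesis"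
  interpret E: ab_left_module E by fact
  obtain n and D :: "nat \<Rightarrow> coord_module" and N g
    where D: "\<And>i. i < n \<Longrightarrow> ab_module_of_rank 1 (D i)"
    and N: "submodule N Atilde (direct_sum_module n D)"
    and g: "g \<in> lmodule_hom Atilde E (restrict_module (direct_sum_module n D) N)"
      "bij_betw g (carrier E) N"
    using assms(1) unfolding semi_simple_def lmodule_isomorphic_def restrict_module_simps by blast
  have carr: "g y \<in> (\<Pi>\<^sub>E i\<in>{..<n}. carrier (D i))" if "y \<in> carrier E" for y
    using subgroup.subset[OF submodule.axioms(1)[OF N]] bij_betwE[OF g(2)] that
    by (auto simp: direct_sum_module_def)
  have "g x i = g \<zero>\<^bsub>E\<^esub> i" if i: "i < n" for i
  proof -
    obtain h p where p: "ab_functional (D i) h p" "inj_on p (carrier (D i))"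
      using functional_if_rank_1[OF D[OF i]] by blast
    have hom: "(\<lambda>y. g y i) \<in> lmodule_hom Atilde E (D i)"
      using g(1) carr i by (auto simp: lmodule_hom_def direct_sum_module_def PiE_mem)
    have "ab_functional E h (\<lambda>y. p (g y i))"
      by (rule functional_comp[OF p(1) hom])
    then have "p (g x i) = 0" "p (g \<zero>\<^bsub>E\<^esub> i) = 0"
      using none assms(3) E.functional_zero by blast+
    then show ?thesis
      using p(2) i PiE_mem[OF carr[OF assms(3)]] PiE_mem[OF carr[OF E.M.zero_closed]]
      by (auto simp: inj_on_def)
  qed
  then have "g x = g \<zero>\<^bsub>E\<^esub>"
    using carr[OF assms(3)] carr[OF E.M.zero_closed] by (intro PiE_ext) auto
  then show False
    using g(2) assms(3,4) by (auto simp: bij_betw_def inj_on_def)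
qed

context ab_left_module
begin

lemma ab_quotient_mapD:
  assumes p: "ab_quotient_map M A B \<mu> p" and B: "submodule B Atilde M"
  shows "x \<in> B \<Longrightarrow> y \<in> B \<Longrightarrow> p (x \<oplus>\<^bsub>M\<^esub> y) = p x + p y"
    and "x \<in> B \<Longrightarrow> y \<in> B \<Longrightarrow> p (x \<ominus>\<^bsub>M\<^esub> y) = p x - p y"
    and "x \<in> B \<Longrightarrow> p (f \<star> x) = f * p x"
    and "x \<in> B \<Longrightarrow> p (ab_a \<odot>\<^bsub>M\<^esub> x) = fps_X ^ 2 * fps_deriv (p x) + ab_weight \<mu> * p x"
    and "x \<in> A \<longleftrightarrow> x \<in> B \<and> p x = 0"
    and "\<exists>x\<in>B. p x = f"
    and "x \<in> B \<Longrightarrow> y \<in> B \<Longrightarrow> p x = p y \<Longrightarrow> p (u \<odot>\<^bsub>M\<^esub> x) = p (u \<odot>\<^bsub>M\<^esub> y)"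
proof -
  interpret B: ab_left_module "restrict_module M B"
    by (rule restrict_left_module[OF B])
  note sub = submoduleD[OF B]
  have fn: "ab_functional (restrict_module M B) (ab_weight \<mu>) p"
    and ker: "{x \<in> B. p x = 0} = A" and surj: "p ` B = UNIV"
    using p by (auto simp: ab_quotient_map_def)
  note fnD = ab_functionalD[OF fn, simplified]
  show add: "p (x \<oplus>\<^bsub>M\<^esub> y) = p x + p y" if "x \<in> B" "y \<in> B" for x y
    using fnD(1) that by simp
  show sm: "p (f \<star> x) = f * p x" if "x \<in> B" for f x
    using fnD(2) that by simp
  show "p (ab_a \<odot>\<^bsub>M\<^esub> x) = fps_X ^ 2 * fps_deriv (p x) + ab_weight \<mu> * p x" if "x \<in> B" for x
    using fnD(3) that by simp
  show "x \<in> A \<longleftrightarrow> x \<in> B \<and> p x = 0" for x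
    using ker by blast
  show "\<exists>x\<in>B. p x = f" for f
    using surj by (metis UNIV_I imageE)
  show "p (x \<ominus>\<^bsub>M\<^esub> y) = p x - p y" if xy: "x \<in> B" "y \<in> B" for x y
  proof -
    have "x \<ominus>\<^bsub>M\<^esub> y = x \<oplus>\<^bsub>M\<^esub> (- 1) \<star> y"
      using xy sub(1) by (auto simp: M.minus_eq ab_of_b_uminus ab_smult_minus)
    then show ?thesis
      using xy sub add[of x "(- 1) \<star> y"] sm[of y "- 1"] by simp
  qed
  show "p (u \<odot>\<^bsub>M\<^esub> x) = p (u \<odot>\<^bsub>M\<^esub> y)" if "x \<in> B" "y \<in> B" "p x = p y" for u x y
    using ab_functional_smult_cong[OF B.ab_left_module_axioms B.ab_left_module_axioms fn fn,
        of x y u] that by simp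
qed

abbreviation root_act :: "complex \<Rightarrow> 'm \<Rightarrow> 'm" where
  "root_act \<mu> x \<equiv> ab_a \<odot>\<^bsub>M\<^esub> x \<ominus>\<^bsub>M\<^esub> ab_weight \<mu> \<star> x"

end

section \<open>Flags, semi-simplicity and resonances\<close>

lemma fps_deriv_X_power: "fps_X * fps_deriv (fps_X ^ n :: complex fps) = of_nat n * fps_X ^ n"
proof (cases n)
  case (Suc m)
  show ?thesis
    unfolding Suc fps_deriv_power by (simp add: algebra_simps fps_of_nat del: of_nat_Suc)
qed simp

lemma fps_X2_deriv_nth: "fps_nth (fps_X ^ 2 * fps_deriv f) n = of_nat (n - 1) * fps_nth (f :: complex fps) (n - 1)"
  by (cases n; cases "n - 1") (auto simp: fps_X_power_mult_nth)

text \<open>Dividing by the nonvanishing solution \<open>u = b\<^sup>N q\<close> removes the potential \<open>h\<close>, and in the resulting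
  equation for \<open>v/q\<close> the coefficient of index \<open>N + n\<close> is resonant.\<close>

lemma resonant_coefficient_zero:
  fixes u v f h :: "complex fps"
  assumes u: "u \<noteq> 0" "fps_X ^ 2 * fps_deriv u + h * u = ab_weight \<alpha> * u"
    and v: "fps_X ^ 2 * fps_deriv v + h * v = ab_weight \<beta> * v + f * u"
    and n: "\<beta> + 1 - \<alpha> = of_nat n"
  shows "fps_nth f n = 0"
proof -
  define N where "N = subdegree u"
  define q where "q = fps_shift N u"
  have uq: "u = fps_X ^ N * q"
    using subdegree_decompose[of u] by (simp add: N_def q_def mult.commute)
  have q0: "fps_nth q 0 \<noteq> 0"
    using u(1) by (simp add: q_def N_def)
  define t where "t = inverse q * v"
  have vt: "v = q * t"
    using q0 by (simp add: t_def mult.assoc[symmetric] inverse_mult_eq_1')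
  \<comment> \<open>Up to the factor b^2 this is the Wronskian of u and v; inserting the two
    equations cancels the potential h.\<close>
  have "(fps_X ^ N * (q * q)) * (fps_X ^ 2 * fps_deriv t) -
      fps_X * (fps_X * fps_deriv (fps_X ^ N)) * (q * q * t) =
      u * (fps_X ^ 2 * fps_deriv v) - v * (fps_X ^ 2 * fps_deriv u)"
    unfolding uq vt by (simp add: algebra_simps power2_eq_square)
  also have "\<dots> = u * (ab_weight \<beta> * v + f * u - h * v) - v * (ab_weight \<alpha> * u - h * u)"
    unfolding u(2)[symmetric] v[symmetric] by simp
  also have "\<dots> = (fps_X ^ N * (q * q)) * ((fps_const \<beta> - fps_const \<alpha>) * fps_X * t + f * fps_X ^ N)"
    unfolding uq vt by (simp add: algebra_simps del: fps_const_sub)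
  finally have "(fps_X ^ N * (q * q)) * (fps_X ^ 2 * fps_deriv t - of_nat N * (fps_X * t)) =
      (fps_X ^ N * (q * q)) * ((fps_const \<beta> - fps_const \<alpha>) * fps_X * t + f * fps_X ^ N)"
    unfolding fps_deriv_X_power by (simp add: algebra_simps)
  moreover have "fps_X ^ N * (q * q) \<noteq> 0"
    using q0 by auto
  ultimately have "fps_X ^ 2 * fps_deriv t - fps_const (of_nat N) * (fps_X * t) =
      fps_const (\<beta> - \<alpha>) * (fps_X * t) + fps_X ^ N * f"
    by (simp add: fps_of_nat mult.commute mult.assoc)
  \<comment> \<open>Write N + n = m + 1. The coefficient of index m of t enters with the factor m -
    N - (\<beta> - \<alpha>) = 0, so only the coefficient of index n of f survives.\<close>
  from arg_cong[OF this, of "\<lambda>s. fps_nth s (N + n)"]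
  have "fps_nth (fps_X ^ 2 * fps_deriv t) (N + n) - of_nat N * fps_nth (fps_X * t) (N + n) =
      (\<beta> - \<alpha>) * fps_nth (fps_X * t) (N + n) + fps_nth f n"
    unfolding fps_sub_nth fps_add_nth fps_mult_left_const_nth fps_X_power_mult_nth by simp
  then show ?thesis
  proof (cases "N + n")
    case (Suc m)
    have "of_nat m + 1 = of_nat N + (of_nat n :: complex)"
      using arg_cong[OF Suc, of "of_nat :: nat \<Rightarrow> complex"] by simp
    moreover have "\<beta> - \<alpha> = of_nat n - 1"
      unfolding n[symmetric] by simp
    ultimately have *: "of_nat m = of_nat N + (\<beta> - \<alpha>)"
      by (metis add_diff_eq add_diff_cancel_right')
    show ?thesis
      using \<open>fps_nth (fps_X ^ 2 * fps_deriv t) (N + n) - _ = _\<close>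
      unfolding fps_X2_deriv_nth Suc by (simp add: * algebra_simps)
  qed (simp add: fps_X2_deriv_nth)
qed

text \<open>A Jordan-Hoelder sequence together with its numbers, phrased through coordinates on the
  quotients; normality of the terms comes from \<open>ab_flag_saturated\<close>.\<close>

definition ab_flag ::
  "(ab_series, 'm) module \<Rightarrow> nat \<Rightarrow> (nat \<Rightarrow> 'm set) \<Rightarrow> (nat \<Rightarrow> complex) \<Rightarrow> bool" where
  "ab_flag E k F lam \<longleftrightarrow> (\<forall>j\<le>k. submodule (F j) Atilde E) \<and> F 0 = {\<zero>\<^bsub>E\<^esub>} \<and> F k = carrier E \<and>
     (\<forall>j<k. \<exists>p. ab_quotient_map E (F j) (F (Suc j)) (lam (Suc j)) p)"

context ab_left_module
begin

lemma ab_flagD: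
  assumes "ab_flag M k F lam"
  shows "j \<le> k \<Longrightarrow> submodule (F j) Atilde M" "F 0 = {\<zero>\<^bsub>M\<^esub>}" "F k = carrier M"
    "j < k \<Longrightarrow> \<exists>p. ab_quotient_map M (F j) (F (Suc j)) (lam (Suc j)) p"
  using assms by (auto simp: ab_flag_def)

lemma ab_flag_Suc_subset:
  assumes "ab_flag M k F lam" "j < k"
  shows "F j \<subseteq> F (Suc j)"
  using ab_flagD(4)[OF assms] unfolding ab_quotient_map_def by blast

lemma ab_flag_mono:
  assumes "ab_flag M k F lam" "i \<le> j" "j \<le> k"
  shows "F i \<subseteq> F j"
  using assms(2,3)
proof (induction rule: dec_induct)
  case (step n)
  then show ?case using ab_flag_Suc_subset[OF assms(1), of n] by auto
qed simp

text \<open>The quotients are torsion-free: descending from \<open>F k\<close> to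
  \<open>F i\<close>, the equation \<open>f * p x = 0\<close> gives \<open>p x = 0\<close> at each
  stage.\<close>

lemma ab_flag_saturated:
  assumes flag: "ab_flag M k F lam" and i: "i \<le> k"
    and x: "x \<in> carrier M" "f \<noteq> 0" "f \<star> x \<in> F i"
  shows "x \<in> F i"
proof -
  have "i \<le> j \<longrightarrow> x \<in> F j" if "j \<le> k" for j
    using that
  proof (induction rule: inc_induct)
    case base
    then show ?case using x(1) ab_flagD(3)[OF flag] by simp
  next
    case (step j)
    show ?case
    proof
      assume ij: "i \<le> j"
      have jk: "j < k" "Suc j \<le> k" using step.hyps by auto
      obtain p where p: "ab_quotient_map M (F j) (F (Suc j)) (lam (Suc j)) p"
        using ab_flagD(4)[OF flag jk(1)] by blast
      note pD = ab_quotient_mapD[OF p ab_flagD(1)[OF flag jk(2)]]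
      have "f \<star> x \<in> F j"
        using x(3) ab_flag_mono[OF flag ij] jk by auto
      moreover have "x \<in> F (Suc j)"
        using step.IH ij by simp
      ultimately show "x \<in> F j"
        using pD(3)[of x f] pD(5) x(2) by simp
    qed
  qed
  then show ?thesis using i by blast
qed

lemma jordan_hoelder_iff_ab_flag:
  "jordan_hoelder M k F \<and> quotients_isomorphic M k F lam \<longleftrightarrow> ab_flag M k F lam" (is "?L \<longleftrightarrow> ?R")
proof
  assume L: ?L
  then have sub: "submodule (F j) Atilde M" if "j \<le> k" for j
    using that by (auto simp: jordan_hoelder_def normal_submodule_def)
  have "\<exists>p. ab_quotient_map M (F j) (F (Suc j)) (lam (Suc j)) p" if "j < k" for j
  proof -
    have "Suc j \<in> {1..k}" using that by simp
    then have "F j \<subseteq> F (Suc j)" "ab_module_of_rank 1 (graded_piece M F (Suc j))"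
      "lmodule_isomorphic Atilde (graded_piece M F (Suc j)) (E_rank1 (lam (Suc j)))"
      using L unfolding jordan_hoelder_def quotients_isomorphic_def by force+
    then show ?thesis
      using quotient_E_rank1_iff[of "F (Suc j)" "F j" "lam (Suc j)"] sub that
      by (simp add: graded_piece_def)
  qed
  then show ?R
    unfolding ab_flag_def using L[unfolded jordan_hoelder_def] sub by blast
next
  assume R: ?R
  note fl = ab_flagD[OF R]
  have normal: "normal_submodule M (F j)" if j: "j \<le> k" for j
  proof -
    note sub = submoduleD[OF fl(1)[OF j]]
    \<comment> \<open>Normality is the saturation property for the series b.\<close>
    have "x \<in> F j" if "x \<in> carrier M" "ab_b \<odot>\<^bsub>M\<^esub> x \<in> F j" for x
      using ab_flag_saturated[OF R j, of x fps_X] that by (simp add: ab_of_b_X)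
    then show ?thesis
      using sub fl(1)[OF j] by (auto simp: normal_submodule_def b_image_def)
  qed
  have "F (j - 1) \<subseteq> F j \<and> ab_module_of_rank 1 (graded_piece M F j) \<and>
      lmodule_isomorphic Atilde (graded_piece M F j) (E_rank1 (lam j))" if j: "j \<in> {1..k}" for j
  proof -
    obtain i where i: "j = Suc i" "i < k"
      using j by (cases j) auto
    then show ?thesis
      using quotient_E_rank1_iff[OF fl(1) fl(1) ab_flag_Suc_subset[OF R i(2)], of "lam j"] fl(4)[OF i(2)]
        ab_flag_Suc_subset[OF R i(2)]
      by (simp add: graded_piece_def)
  qed
  then show ?L
    unfolding jordan_hoelder_def quotients_isomorphic_def using normal fl(2,3) by blast
qed

text \<open>If \<open>p\<close> vanishes on \<open>F\<^sub>m\<close> but not at a generator \<open>e\<close> of \<open>F\<^sub>m\<^sub>+\<^sub>1/F\<^sub>m\<close>, then the determinants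
  \<open>p(e) q - q(e) p\<close> vanish on \<open>F\<^sub>m\<^sub>+\<^sub>1\<close>.\<close>

lemma separating_functional:
  assumes flag: "ab_flag M k F lam"
    and sep: "\<And>x. \<lbrakk>x \<in> carrier M; x \<noteq> \<zero>\<^bsub>M\<^esub>\<rbrakk> \<Longrightarrow> \<exists>h p. ab_functional M h p \<and> p x \<noteq> 0"
    and "m \<le> k" "x \<in> carrier M" "x \<notin> F m"
  shows "\<exists>h p. ab_functional M h p \<and> (\<forall>y\<in>F m. p y = 0) \<and> p x \<noteq> 0"
  using assms(3-)
proof (induction m arbitrary: x)
  case 0
  then have "x \<noteq> \<zero>\<^bsub>M\<^esub>"
    using ab_flagD(2)[OF flag] by simp
  from sep[OF 0(2) this] obtain h p where "ab_functional M h p" "p x \<noteq> 0"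
    by blast
  then show ?case
    using functional_zero ab_flagD(2)[OF flag] by auto
next
  case (Suc m)
  have m: "m < k" "m \<le> k" using Suc.prems by auto
  obtain r where r: "ab_quotient_map M (F m) (F (Suc m)) (lam (Suc m)) r"
    using ab_flagD(4)[OF flag m(1)] by blast
  note sub = submoduleD[OF ab_flagD(1)[OF flag Suc.prems(1)]]
  note subm = submoduleD[OF ab_flagD(1)[OF flag m(2)]]
  note rD = ab_quotient_mapD[OF r ab_flagD(1)[OF flag Suc.prems(1)]]
  let ?l = "ab_weight (lam (Suc m))"
  obtain e where e: "e \<in> F (Suc m)" "r e = 1"
    using rD(6) by blast
  have ec: "e \<in> carrier M"
    using e sub by blast
  obtain h p where p: "ab_functional M h p" "\<forall>y\<in>F m. p y = 0" "p e \<noteq> 0"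
    using Suc.IH[OF m(2) ec] rD(5)[of e] e by (metis one_neq_zero)
  note pD = ab_functionalD[OF p(1)]
  have De: "root_act (lam (Suc m)) e \<in> F m"
    using e sub by (simp add: rD(2-5))
  \<comment> \<open>Chosen so that the determinant t defined below satisfies
    \<open>t x = q y\<close>, where q is a functional separating y from \<open>F m\<close>.\<close>
  define y where "y = p e \<star> x \<ominus>\<^bsub>M\<^esub> p x \<star> e"
  have yc: "y \<in> carrier M"
    using Suc.prems ec by (simp add: y_def)
  have "y \<notin> F m"
  proof
    assume "y \<in> F m"
    then have "y \<oplus>\<^bsub>M\<^esub> p x \<star> e \<in> F (Suc m)"
      using ab_flag_Suc_subset[OF flag m(1)] sub e by auto
    then have "p e \<star> x \<in> F (Suc m)"
      using Suc.prems ec by (simp add: y_def M.minus_eq M.a_assoc M.l_neg)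
    then show False
      using ab_flag_saturated[OF flag Suc.prems(1,2) p(3)] Suc.prems(3) by simp
  qed
  then obtain h' q where q: "ab_functional M h' q" "\<forall>y\<in>F m. q y = 0" "q y \<noteq> 0"
    using Suc.IH[OF m(2) yc] by blast
  note qD = ab_functionalD[OF q(1)]
  \<comment> \<open>Since a - \<lambda> b maps e into \<open>F m\<close>, the value at e of any
    functional vanishing on \<open>F m\<close> solves a first order equation.\<close>
  have eig: "fps_X ^ 2 * fps_deriv (s e) = ?l * s e - g * s e"
    if s: "ab_functional M g s" "\<forall>y\<in>F m. s y = 0" for g s
    using bspec[OF s(2) De] ec functional_diff[OF s(1)] ab_functionalD[OF s(1)]
    by (simp add: algebra_simps)
  define t where "t z = p e * q z - q e * p z" for z
  \<comment> \<open>By \<open>eig\<close> the factor \<open>p e\<close> shifts the potential h' of q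
    by \<open>h - ?l\<close>, and \<open>q e\<close> shifts the potential h of p by
    \<open>h' - ?l\<close>; both terms of t end up with the same potential.\<close>
  have "ab_functional M (h + h' - ?l) t"
    unfolding ab_functional_def
  proof (intro conjI ballI allI)
    fix z assume z: "z \<in> carrier M"
    have "fps_X ^ 2 * fps_deriv (t z) = (fps_X ^ 2 * fps_deriv (p e)) * q z +
        p e * (fps_X ^ 2 * fps_deriv (q z)) - (fps_X ^ 2 * fps_deriv (q e)) * p z -
        q e * (fps_X ^ 2 * fps_deriv (p z))"
      unfolding t_def by (simp add: algebra_simps)
    also have "\<dots> = (?l * p e - h * p e) * q z +
        p e * (fps_X ^ 2 * fps_deriv (q z)) - (?l * q e - h' * q e) * p z -
        q e * (fps_X ^ 2 * fps_deriv (p z))"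
      unfolding eig[OF p(1,2)] eig[OF q(1,2)] ..
    finally show "t (ab_a \<odot>\<^bsub>M\<^esub> z) = fps_X ^ 2 * fps_deriv (t z) + (h + h' - ?l) * t z"
      using z unfolding t_def by (simp add: pD qD algebra_simps)
  qed (simp_all add: t_def pD qD algebra_simps)
  moreover have "t z = 0" if z: "z \<in> F (Suc m)" for z
  proof -
    have zc: "z \<in> carrier M" using z sub by blast
    have "z \<ominus>\<^bsub>M\<^esub> r z \<star> e \<in> F m"
      using z e sub by (simp add: rD(2-5))
    then have "p z = r z * p e" "q z = r z * q e"
      using p(2) q(2) zc ec functional_diff[OF p(1)] functional_diff[OF q(1)]
      by (force simp: pD qD)+
    then show ?thesis by (simp add: t_def)
  qed
  moreover have "t x = q y"
    using Suc.prems ec by (simp add: t_def y_def functional_diff[OF q(1)] qD mult.commute)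
  ultimately show ?case
    using q(3) by (intro exI[of _ "h + h' - ?l"] exI[of _ t]) simp
qed

end

section \<open>Resonant entries, generators and the exchange of two neighbouring quotients\<close>

context ab_left_module
begin

lemma root_smult:
  "x \<in> carrier M \<Longrightarrow> (ab_a - ab_mult (ab_scalar \<mu>) ab_b) \<odot>\<^bsub>M\<^esub> x = root_act \<mu> x"
  using ab_smult_add_left[of x ab_a "- ab_of_b (ab_weight \<mu>)"]
  by (simp add: ab_weight_of_b ab_smult_minus M.minus_eq)

text \<open>The derivative of the constant 1 is zero, so p takes the value \<mu> b both at a x and
  at \<mu> b x.\<close>

lemma root_act_mem:
  assumes "ab_quotient_map M A B \<mu> p" "submodule B Atilde M" "x \<in> B" "p x = 1"
  shows "root_act \<mu> x \<in> A"
  using ab_quotient_mapD(2-5)[OF assms(1,2)] submoduleD[OF assms(2)] assms(3,4) by simp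

text \<open>Choose a functional q vanishing on \<open>F j\<close> but not at a lift e of 1 under r.
  Then \<open>q e\<close> and \<open>q x\<close> solve the two equations of
  \<open>resonant_coefficient_zero\<close>, whose inhomogeneous term is the entry considered
  here.\<close>

lemma resonant_entry_zero:
  assumes flag: "ab_flag M k F lam"
    and sep: "\<And>x. \<lbrakk>x \<in> carrier M; x \<noteq> \<zero>\<^bsub>M\<^esub>\<rbrakk> \<Longrightarrow> \<exists>h p. ab_functional M h p \<and> p x \<noteq> 0"
    and j: "Suc j < k"
    and r: "ab_quotient_map M (F j) (F (Suc j)) \<alpha> r"
    and p: "ab_quotient_map M (F (Suc j)) (F (Suc (Suc j))) \<beta> p"
    and x: "x \<in> F (Suc (Suc j))" "p x = 1"
    and n: "\<beta> + 1 - \<alpha> = of_nat n"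
  shows "fps_nth (r (root_act \<beta> x)) n = 0"
proof -
  have B: "submodule (F (Suc j)) Atilde M" and C: "submodule (F (Suc (Suc j))) Atilde M"
    using ab_flagD(1)[OF flag] j by auto
  note rD = ab_quotient_mapD[OF r B]
  note subB = submoduleD[OF B] and subC = submoduleD[OF C]
  let ?y = "root_act \<beta> x"
  have yB: "?y \<in> F (Suc j)"
    by (rule root_act_mem[OF p C x])
  obtain e where e: "e \<in> F (Suc j)" "r e = 1"
    using rD(6) by blast
  have ec: "e \<in> carrier M" and xc: "x \<in> carrier M" and yc: "?y \<in> carrier M"
    using e x subB(1) subC(1) by auto
  have "e \<notin> F j"
    using rD(5)[of e] e by simp
  then obtain h q where q: "ab_functional M h q" "\<forall>y\<in>F j. q y = 0" "q e \<noteq> 0"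
    using separating_functional[OF flag sep _ ec, of j] j by force
  note qD = ab_functionalD[OF q(1)]
  have "q (root_act \<alpha> e) = 0"
    using q(2) root_act_mem[OF r B e] by blast
  then have 1: "fps_X ^ 2 * fps_deriv (q e) + h * q e = ab_weight \<alpha> * q e"
    using ec by (simp add: functional_diff[OF q(1)] qD)
  have "?y \<ominus>\<^bsub>M\<^esub> r ?y \<star> e \<in> F j"
    using yB e subB(5,6) rD(5)[of "?y \<ominus>\<^bsub>M\<^esub> r ?y \<star> e"] rD(2,3) by simp
  then have "q (?y \<ominus>\<^bsub>M\<^esub> r ?y \<star> e) = 0"
    using q(2) by blast
  then have 2: "fps_X ^ 2 * fps_deriv (q x) + h * q x = ab_weight \<beta> * q x + r ?y * q e"
    using ec xc yc by (simp add: functional_diff[OF q(1)] qD algebra_simps)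
  show ?thesis
    by (rule resonant_coefficient_zero[OF q(3) 1 2 n])
qed

text \<open>If b divided \<open>p g\<close>, it would divide every value of p on B, as a factor b
  can be moved to the left past any series; but p takes the value 1.\<close>

lemma generator_unit:
  assumes p: "ab_quotient_map M A B \<mu> p" and B: "submodule B Atilde M"
    and g: "g \<in> B" "B \<subseteq> range (\<lambda>u. u \<odot>\<^bsub>M\<^esub> g)"
  shows "fps_nth (p g) 0 \<noteq> 0"
proof
  assume "fps_nth (p g) 0 = 0"
  then have "p g = fps_X * fps_shift 1 (p g)"
    by (intro fps_ext) simp
  note pD = ab_quotient_mapD[OF p B]
  note sub = submoduleD[OF B]
  obtain x where x: "x \<in> B" "p x = 1"
    using pD(6) by blast
  obtain u where u: "x = u \<odot>\<^bsub>M\<^esub> g"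
    using x g(2) by blast
  obtain y where y: "y \<in> B" "p y = fps_shift 1 (p g)"
    using pD(6) by blast
  define v where "v = u + ab_b * ab_del u"
  have yc: "y \<in> carrier M" using y sub(1) by blast
  have "p g = p (fps_X \<star> y)"
    using \<open>p g = fps_X * fps_shift 1 (p g)\<close> y by (simp add: pD(3))
  \<comment> \<open>The value of p at u g depends only on u and \<open>p g\<close>, so g may be
    replaced by b y; then u b = b v.\<close>
  then have "p x = p (u \<odot>\<^bsub>M\<^esub> (fps_X \<star> y))"
    unfolding u by (intro pD(7)) (use g y sub(6) in auto)
  also have "u \<odot>\<^bsub>M\<^esub> (fps_X \<star> y) = fps_X \<star> (v \<odot>\<^bsub>M\<^esub> y)"
    using yc ab_mult_b_shift[of u] by (simp add: ab_smult_smult ab_of_b_X v_def)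
  also have "p \<dots> = fps_X * p (v \<odot>\<^bsub>M\<^esub> y)"
    using y sub(6) by (intro pD(3)) auto
  finally show False
    using x(2) by (auto simp: fps_eq_iff dest: spec[of _ 0])
qed

text \<open>Normalise the generator to x with \<open>p x = 1\<close>. For an element of A written as
  a multiple of x, divide the multiplier by a - \<mu> b; applying p shows that the remainder is
  zero.\<close>

lemma generator_step:
  assumes p: "ab_quotient_map M A B \<mu> p" and A: "submodule A Atilde M" and B: "submodule B Atilde M"
    and g: "g \<in> B" "B \<subseteq> range (\<lambda>u. u \<odot>\<^bsub>M\<^esub> g)"
  shows "\<exists>x\<in>B. p x = 1 \<and> A \<subseteq> range (\<lambda>u. u \<odot>\<^bsub>M\<^esub> root_act \<mu> x)"
proof -
  note pD = ab_quotient_mapD[OF p B]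
  note sub = submoduleD[OF B] and subA = submoduleD[OF A]
  have unit: "inverse (p g) * p g = 1"
    using generator_unit[OF p B g] by (rule inverse_mult_eq_1)
  define x where "x = inverse (p g) \<star> g"
  have gc: "g \<in> carrier M" using g sub(1) by blast
  have xB: "x \<in> B" and xc: "x \<in> carrier M" and px: "p x = 1"
    using g gc sub(6) unit by (simp_all add: x_def pD(3))
  have gx: "g = p g \<star> x"
    using gc unit by (simp add: x_def b_smult_smult mult.commute)
  have "z \<in> range (\<lambda>u. u \<odot>\<^bsub>M\<^esub> root_act \<mu> x)" if zA: "z \<in> A" for z
  proof -
    have zB: "z \<in> B" "p z = 0"
      using zA pD(5) by auto
    then obtain v where "z = v \<odot>\<^bsub>M\<^esub> g"
      using g(2) by blast
    then have z: "z = ab_mult v (ab_of_b (p g)) \<odot>\<^bsub>M\<^esub> x"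
      using xc arg_cong[OF gx, of "\<lambda>y. v \<odot>\<^bsub>M\<^esub> y"] by (simp add: ab_smult_smult)
    obtain w f where wf: "ab_mult v (ab_of_b (p g)) =
        ab_mult w (ab_a - ab_mult (ab_scalar \<mu>) ab_b) + ab_of_b f"
      using ab_division by blast
    have z': "z = w \<odot>\<^bsub>M\<^esub> root_act \<mu> x \<oplus>\<^bsub>M\<^esub> f \<star> x"
      unfolding z wf using xc by (simp add: ab_smult_add_left flip: root_smult ab_smult_smult)
    have wA: "w \<odot>\<^bsub>M\<^esub> root_act \<mu> x \<in> A"
      using root_act_mem[OF p B xB px] subA(6) by blast
    then have wB: "w \<odot>\<^bsub>M\<^esub> root_act \<mu> x \<in> B" "p (w \<odot>\<^bsub>M\<^esub> root_act \<mu> x) = 0"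
      using pD(5) by auto
    have "p z = p (w \<odot>\<^bsub>M\<^esub> root_act \<mu> x) + p (f \<star> x)"
      unfolding z' by (rule pD(1)) (use wB xB sub(6) in auto)
    then have "f = 0"
      using zB wB px xB by (simp add: pD(3))
    then have "z = w \<odot>\<^bsub>M\<^esub> root_act \<mu> x"
      using z' wB(1) sub(1) xc by auto
    then show ?thesis by blast
  qed
  then show ?thesis
    using xB px by blast
qed

lemma submodules_monogenic:
  assumes flag: "ab_flag M k F lam"
    and g: "g \<in> carrier M" "carrier M \<subseteq> range (\<lambda>u. u \<odot>\<^bsub>M\<^esub> g)"
    and "j \<le> k"
  shows "\<exists>x\<in>F j. F j \<subseteq> range (\<lambda>u. u \<odot>\<^bsub>M\<^esub> x)"
  using assms(4)
proof (induction rule: inc_induct)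
  case base
  then show ?case using g ab_flagD(3)[OF flag] by auto
next
  case (step j)
  have A: "submodule (F j) Atilde M" and B: "submodule (F (Suc j)) Atilde M"
    using ab_flagD(1)[OF flag] step.hyps by auto
  obtain p where p: "ab_quotient_map M (F j) (F (Suc j)) (lam (Suc j)) p"
    using ab_flagD(4)[OF flag step.hyps(2)] by blast
  show ?case
    using step.IH generator_step[OF p A B] root_act_mem[OF p B] by metis
qed

text \<open>For the lift y of 1 given by \<open>generator_step\<close>, (a - \<beta> b) y generates
  \<open>F (Suc j)\<close>, so its value is a unit by \<open>generator_unit\<close>. Passing from y
  to x adds an element z of \<open>F (Suc j)\<close>, which changes the value by a multiple of
  b.\<close>

lemma superdiagonal_unit:
  assumes flag: "ab_flag M k F lam"
    and g: "g \<in> carrier M" "carrier M \<subseteq> range (\<lambda>u. u \<odot>\<^bsub>M\<^esub> g)"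
    and j: "Suc j < k"
    and r: "ab_quotient_map M (F j) (F (Suc j)) \<alpha> r"
    and p: "ab_quotient_map M (F (Suc j)) (F (Suc (Suc j))) \<beta> p"
    and x: "x \<in> F (Suc (Suc j))" "p x = 1"
  shows "fps_nth (r (root_act \<beta> x)) 0 \<noteq> 0"
proof -
  have B: "submodule (F (Suc j)) Atilde M" and C: "submodule (F (Suc (Suc j))) Atilde M"
    using ab_flagD(1)[OF flag] j by auto
  note rD = ab_quotient_mapD[OF r B] and pD = ab_quotient_mapD[OF p C]
  note subB = submoduleD[OF B] and subC = submoduleD[OF C]
  obtain y where y: "y \<in> F (Suc (Suc j))" "p y = 1"
      "F (Suc j) \<subseteq> range (\<lambda>u. u \<odot>\<^bsub>M\<^esub> root_act \<beta> y)"
    using submodules_monogenic[OF flag g, of "Suc (Suc j)"] j generator_step[OF p B C] by force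
  have yB: "root_act \<beta> y \<in> F (Suc j)"
    by (rule root_act_mem[OF p C y(1,2)])
  define z where "z = x \<ominus>\<^bsub>M\<^esub> y"
  have zB: "z \<in> F (Suc j)"
    using x y subC(5) pD(2,5) by (simp add: z_def)
  have c: "x \<in> carrier M" "y \<in> carrier M" "z \<in> carrier M"
    using x y zB subB(1) subC(1) by auto
  have "x = y \<oplus>\<^bsub>M\<^esub> z"
    using c(1,2) by (simp add: z_def M.minus_eq M.a_ac M.r_neg)
  then have "root_act \<beta> x = root_act \<beta> y \<oplus>\<^bsub>M\<^esub> root_act \<beta> z"
    using c(2,3) root_smult ab_smult_add_right by (metis M.add.m_closed)
  then have "r (root_act \<beta> x) = r (root_act \<beta> y) + r (root_act \<beta> z)"
    using yB zB subB(5,6) rD(1) by simp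
  also have "r (root_act \<beta> z) = fps_X ^ 2 * fps_deriv (r z) + ab_weight \<alpha> * r z - ab_weight \<beta> * r z"
    using zB subB(6) rD(2-4) by simp
  finally show ?thesis
    using generator_unit[OF r B yB y(3)] by (simp add: power2_eq_square)
qed

text \<open>If \<open>(r, p)\<close> are the coordinates of \<open>x\<close> in \<open>C/A\<close> with respect to \<open>e \<in> B\<close> and \<open>e' \<in> C\<close>, the solution
  \<open>h\<close> below makes \<open>h e + b e'\<close> an eigenvector modulo \<open>A\<close>; it spans the kernel of \<open>h p - b r\<close>, and
  \<open>r/h\<close> is the coordinate on this kernel.\<close>

lemma exchange:
  assumes A: "submodule A Atilde M" and B: "submodule B Atilde M" and C: "submodule C Atilde M"
    and r: "ab_quotient_map M A B \<alpha> r" and p: "ab_quotient_map M B C \<beta> p"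
    and e': "e' \<in> C" "p e' = 1"
    and unit: "fps_nth (r (root_act \<beta> e')) 0 \<noteq> 0"
    and res: "\<And>n. \<beta> + 1 - \<alpha> = of_nat n \<Longrightarrow> fps_nth (r (root_act \<beta> e')) n = 0"
  shows "\<exists>B' r' p'. submodule B' Atilde M \<and> ab_quotient_map M A B' (\<beta> + 1) r' \<and>
    ab_quotient_map M B' C (\<alpha> - 1) p'"
proof -
  note rD = ab_quotient_mapD[OF r B] and pD = ab_quotient_mapD[OF p C]
  note subA = submoduleD[OF A] and subB = submoduleD[OF B] and subC = submoduleD[OF C]
  define d where "d = root_act \<beta> e'"
  define f where "f = r d"
  \<comment> \<open>In the resonant case \<open>\<beta> + 1 - \<alpha> = n\<close> the coefficient of index \<open>n\<close> is \<open>0/0 = 0\<close>.\<close>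
  define h where "h = Abs_fps (\<lambda>n. fps_nth f n / (\<beta> + 1 - \<alpha> - of_nat n))"
  have dB: "d \<in> B"
    unfolding d_def by (rule root_act_mem[OF p C e'])
  have f: "fps_nth f n = (\<beta> + 1 - \<alpha> - of_nat n) * fps_nth h n" for n
    using res[of n] by (auto simp: h_def f_def d_def)
  \<comment> \<open>At index 0 the recursion reads
    \<open>fps_nth f 0 = (\<beta> + 1 - \<alpha>) * fps_nth h 0\<close>, and the left side is
    nonzero by \<open>unit\<close>.\<close>
  have h0: "fps_nth h 0 \<noteq> 0"
    using f[of 0] unit by (auto simp: f_def d_def)
  have hf: "f = fps_const (\<beta> + 1 - \<alpha>) * h - fps_X * fps_deriv h"
  proof (rule fps_ext)
    fix n
    show "fps_nth f n = fps_nth (fps_const (\<beta> + 1 - \<alpha>) * h - fps_X * fps_deriv h) n"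
      by (cases n) (simp_all add: f algebra_simps)
  qed
  have hi: "inverse h * h = 1"
    using h0 by (rule inverse_mult_eq_1)
  have BC: "B \<subseteq> C"
    using pD(5) by blast
  have carr: "x \<in> carrier M" if "x \<in> C" for x
    using that subC(1) by blast
  \<comment> \<open>The r-coordinate of the component in B of C = B + C[[b]] e'. It is linear over
    C[[b]], but a produces the cross term \<open>p x * f\<close> in \<open>s_a\<close>.\<close>
  define s where "s x = r (x \<ominus>\<^bsub>M\<^esub> p x \<star> e')" for x
  have p_eq: "p (z \<oplus>\<^bsub>M\<^esub> c \<star> e') = c" and s_eq: "s (z \<oplus>\<^bsub>M\<^esub> c \<star> e') = r z" if z: "z \<in> B" for z c
  proof -
    have zC: "z \<in> C" "p z = 0"
      using z pD(5) by auto
    show *: "p (z \<oplus>\<^bsub>M\<^esub> c \<star> e') = c"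
      using zC e' subC(6) by (simp add: pD(1,3))
    have "(z \<oplus>\<^bsub>M\<^esub> c \<star> e') \<ominus>\<^bsub>M\<^esub> c \<star> e' = z"
      using carr[OF zC(1)] carr[OF e'(1)] by (simp add: M.minus_eq M.a_assoc M.r_neg)
    then show "s (z \<oplus>\<^bsub>M\<^esub> c \<star> e') = r z"
      unfolding s_def * by simp
  qed
  have decomp: "\<exists>z\<in>B. x = z \<oplus>\<^bsub>M\<^esub> p x \<star> e'" if x: "x \<in> C" for x
  proof (rule bexI)
    show "x = (x \<ominus>\<^bsub>M\<^esub> p x \<star> e') \<oplus>\<^bsub>M\<^esub> p x \<star> e'"
      using carr[OF x] carr[OF e'(1)] by (simp add: M.minus_eq M.a_assoc M.l_neg)
    show "x \<ominus>\<^bsub>M\<^esub> p x \<star> e' \<in> B"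
      using x e' subC(5,6) pD(2,3,5) by simp
  qed
  have s_add: "s (x \<oplus>\<^bsub>M\<^esub> y) = s x + s y" if xy: "x \<in> C" "y \<in> C" for x y
  proof -
    obtain z w where zw: "z \<in> B" "x = z \<oplus>\<^bsub>M\<^esub> p x \<star> e'" "w \<in> B" "y = w \<oplus>\<^bsub>M\<^esub> p y \<star> e'"
      using decomp xy by metis
    have c: "z \<in> carrier M" "w \<in> carrier M" "e' \<in> carrier M"
      using zw e' BC carr by auto
    have "x \<oplus>\<^bsub>M\<^esub> y = (z \<oplus>\<^bsub>M\<^esub> p x \<star> e') \<oplus>\<^bsub>M\<^esub> (w \<oplus>\<^bsub>M\<^esub> p y \<star> e')"
      using zw by simp
    also have "\<dots> = (z \<oplus>\<^bsub>M\<^esub> w) \<oplus>\<^bsub>M\<^esub> (p x + p y) \<star> e'"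
      using c by (simp add: ab_of_b_add ab_smult_add_left M.a_ac)
    finally have "s (x \<oplus>\<^bsub>M\<^esub> y) = r (z \<oplus>\<^bsub>M\<^esub> w)"
      using s_eq[OF subB(3)[OF zw(1,3)]] by simp
    also have "\<dots> = s x + s y"
      using s_eq[OF zw(1), of "p x"] s_eq[OF zw(3), of "p y"] zw by (simp add: rD(1))
    finally show ?thesis .
  qed
  have s_smult: "s (g \<star> x) = g * s x" if x: "x \<in> C" for g x
  proof -
    obtain z where z: "z \<in> B" "x = z \<oplus>\<^bsub>M\<^esub> p x \<star> e'"
      using decomp x by metis
    have c: "z \<in> carrier M" "e' \<in> carrier M"
      using z e' BC carr by auto
    have "g \<star> x = g \<star> (z \<oplus>\<^bsub>M\<^esub> p x \<star> e')"
      using z by simp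
    also have "\<dots> = g \<star> z \<oplus>\<^bsub>M\<^esub> (g * p x) \<star> e'"
      using c by (simp add: ab_smult_add_right b_smult_smult)
    finally have "s (g \<star> x) = r (g \<star> z)"
      using s_eq[OF subB(6)[OF z(1)]] by simp
    also have "\<dots> = g * s x"
      using s_eq[OF z(1), of "p x"] z by (simp add: rD(3))
    finally show ?thesis .
  qed
  have s_a: "s (ab_a \<odot>\<^bsub>M\<^esub> x) = fps_X ^ 2 * fps_deriv (s x) + ab_weight \<alpha> * s x + p x * f" if x: "x \<in> C" for x
  proof -
    obtain z where z: "z \<in> B" "x = z \<oplus>\<^bsub>M\<^esub> p x \<star> e'"
      using decomp x by metis
    have c: "z \<in> carrier M" "e' \<in> carrier M" "d \<in> carrier M"
      using z e' BC carr dB by auto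
    have ae: "ab_a \<odot>\<^bsub>M\<^esub> e' = d \<oplus>\<^bsub>M\<^esub> ab_weight \<beta> \<star> e'"
      using c by (simp add: d_def M.minus_eq M.a_assoc M.l_neg)
    have "ab_a \<odot>\<^bsub>M\<^esub> x = ab_a \<odot>\<^bsub>M\<^esub> (z \<oplus>\<^bsub>M\<^esub> p x \<star> e')"
      using z by simp
    also have "\<dots> = ab_a \<odot>\<^bsub>M\<^esub> z \<oplus>\<^bsub>M\<^esub> (p x \<star> (d \<oplus>\<^bsub>M\<^esub> ab_weight \<beta> \<star> e') \<oplus>\<^bsub>M\<^esub> (fps_X ^ 2 * fps_deriv (p x)) \<star> e')"
      using c by (simp add: ab_smult_add_right a_b_smult ae)
    also have "\<dots> = (ab_a \<odot>\<^bsub>M\<^esub> z \<oplus>\<^bsub>M\<^esub> p x \<star> d) \<oplus>\<^bsub>M\<^esub>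
        (p x * ab_weight \<beta> + fps_X ^ 2 * fps_deriv (p x)) \<star> e'"
      using c by (simp add: ab_smult_add_right ab_smult_add_left b_smult_smult ab_of_b_add M.a_ac)
    finally have "s (ab_a \<odot>\<^bsub>M\<^esub> x) = r (ab_a \<odot>\<^bsub>M\<^esub> z \<oplus>\<^bsub>M\<^esub> p x \<star> d)"
      using s_eq[OF subB(3)[OF subB(6)[OF z(1)] subB(6)[OF dB]]] by simp
    also have "\<dots> = fps_X ^ 2 * fps_deriv (r z) + ab_weight \<alpha> * r z + p x * f"
      using z dB subB(6) by (simp add: rD(1,3,4) f_def)
    also have "r z = s x"
      using s_eq[OF z(1), of "p x"] z by simp
    finally show ?thesis .
  qed
  have s_A: "x \<in> A \<longleftrightarrow> x \<in> C \<and> p x = 0 \<and> s x = 0" for x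
  proof -
    have "s x = r x" if "x \<in> B"
      using s_eq[OF that, of 0] that BC carr carr[OF e'(1)] by (auto simp: subset_iff)
    then show ?thesis
      using rD(5) pD(5) by metis
  qed
  \<comment> \<open>By \<open>hf\<close> the cross term b f p shifts the weight \<beta> of h p to
    \<alpha> - 1 and supplies the derivative of h; the factor b shifts the weight \<alpha> of s to
    \<alpha> - 1 as well.\<close>
  define p' where "p' x = h * p x - fps_X * s x" for x
  define B' where "B' = {x \<in> C. p' x = 0}"
  define r' where "r' x = inverse h * s x" for x
  have p'fun: "ab_functional (restrict_module M C) (ab_weight (\<alpha> - 1)) p'"
    unfolding ab_functional_def restrict_module_simps
  proof (intro conjI ballI allI)
    fix x assume x: "x \<in> C"
    show "p' (ab_a \<odot>\<^bsub>M\<^esub> x) = fps_X ^ 2 * fps_deriv (p' x) + ab_weight (\<alpha> - 1) * p' x"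
      using x unfolding p'_def
      by (simp add: pD(4) s_a hf algebra_simps power2_eq_square flip: fps_const_add fps_const_sub)
  qed (simp_all add: p'_def pD(1,3) s_add s_smult algebra_simps)
  have B'sub: "submodule B' Atilde M"
    unfolding B'_def by (rule kernel_submodule[OF C p'fun])
  have B'C: "B' \<subseteq> C"
    by (auto simp: B'_def)
  have "p' ` C = UNIV"
  proof -
    have "p' (c \<star> inverse h \<star> e') = c" for c
    proof -
      have "c \<star> inverse h \<star> e' = \<zero>\<^bsub>M\<^esub> \<oplus>\<^bsub>M\<^esub> (c * inverse h) \<star> e'"
        using carr[OF e'(1)] by (simp add: b_smult_smult)
      then have "p (c \<star> inverse h \<star> e') = c * inverse h" "s (c \<star> inverse h \<star> e') = 0"
        using p_eq[OF subB(2)] s_eq[OF subB(2)] rD(5)[of "\<zero>\<^bsub>M\<^esub>"] subA(2) by auto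
      then show ?thesis
        using hi by (simp add: p'_def algebra_simps)
    qed
    moreover have "c \<star> inverse h \<star> e' \<in> C" for c
      using e' subC(6) by blast
    ultimately show ?thesis by (metis UNIV_eq_I imageI)
  qed
  then have qp': "ab_quotient_map M B' C (\<alpha> - 1) p'"
    using p'fun by (auto simp: ab_quotient_map_def B'_def)
  \<comment> \<open>On B' the coordinates (s, p) are r' times (h, b), the coordinates of the
    eigenvector h e + b e'.\<close>
  have B'D: "x \<in> C" "p x = fps_X * r' x" "s x = h * r' x" if x: "x \<in> B'" for x
  proof -
    show "x \<in> C" using x B'C by blast
    have "h * p x = fps_X * s x"
      using x by (simp add: B'_def p'_def)
    then have "(inverse h * h) * p x = fps_X * r' x"
      by (simp add: r'_def algebra_simps)
    then show "p x = fps_X * r' x"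
      using hi by simp
    have "(inverse h * h) * s x = h * r' x"
      by (simp add: r'_def algebra_simps)
    then show "s x = h * r' x"
      using hi by simp
  qed
  have r'fun: "ab_functional (restrict_module M B') (ab_weight (\<beta> + 1)) r'"
    unfolding ab_functional_def restrict_module_simps
  proof (intro conjI ballI allI)
    fix x assume x: "x \<in> B'"
    have "s (ab_a \<odot>\<^bsub>M\<^esub> x) = fps_X ^ 2 * fps_deriv (h * r' x) + ab_weight \<alpha> * (h * r' x) + fps_X * r' x * f"
      using B'D[OF x] s_a[of x] by simp
    also have "\<dots> = h * (fps_X ^ 2 * fps_deriv (r' x) + ab_weight (\<beta> + 1) * r' x)"
      by (simp add: hf algebra_simps power2_eq_square flip: fps_const_add fps_const_sub)
    finally have "r' (ab_a \<odot>\<^bsub>M\<^esub> x) = (inverse h * h) * (fps_X ^ 2 * fps_deriv (r' x) + ab_weight (\<beta> + 1) * r' x)"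
      unfolding r'_def[of "ab_a \<odot>\<^bsub>M\<^esub> x"] by (simp only: mult.assoc)
    then show "r' (ab_a \<odot>\<^bsub>M\<^esub> x) = fps_X ^ 2 * fps_deriv (r' x) + ab_weight (\<beta> + 1) * r' x"
      using hi by simp
  qed (use B'C in \<open>auto simp: r'_def s_add s_smult algebra_simps subset_iff\<close>)
  have "x \<in> A \<longleftrightarrow> x \<in> B' \<and> r' x = 0" for x
  proof
    assume "x \<in> A"
    then show "x \<in> B' \<and> r' x = 0"
      using s_A[of x] by (simp add: B'_def p'_def r'_def)
  next
    assume x: "x \<in> B' \<and> r' x = 0"
    then show "x \<in> A"
      using s_A[of x] B'D[of x] by simp
  qed
  moreover have "\<exists>x\<in>B'. r' x = c" for c
  proof -
    \<comment> \<open>Modulo A the point \<open>?x\<close> is c times the eigenvector h e + b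
      e'.\<close>
    obtain z where z: "z \<in> B" "r z = h * c"
      using rD(6) by blast
    let ?x = "z \<oplus>\<^bsub>M\<^esub> (fps_X * c) \<star> e'"
    have x: "p ?x = fps_X * c" "s ?x = h * c"
      using p_eq[OF z(1)] s_eq[OF z(1)] z(2) by simp_all
    moreover have "?x \<in> C"
      using z BC e' subC(3,6) by blast
    ultimately have "?x \<in> B'"
      by (simp add: B'_def p'_def algebra_simps)
    moreover have "r' ?x = c"
      using hi by (simp add: r'_def x mult.assoc[symmetric])
    ultimately show ?thesis by blast
  qed
  ultimately have "ab_quotient_map M A B' (\<beta> + 1) r'"
    using r'fun unfolding ab_quotient_map_def by (metis (mono_tags, lifting) Collect_cong Collect_mem_eq UNIV_eq_I imageI)
  then show ?thesis
    using B'sub qp' by blast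
qed

text \<open>Only the term \<open>F (Suc j)\<close> is replaced. The generator g and the separating
  functionals belong to the whole module, so the exchange can be iterated.\<close>

lemma ab_flag_exchange:
  assumes flag: "ab_flag M k F lam"
    and sep: "\<And>x. \<lbrakk>x \<in> carrier M; x \<noteq> \<zero>\<^bsub>M\<^esub>\<rbrakk> \<Longrightarrow> \<exists>h p. ab_functional M h p \<and> p x \<noteq> 0"
    and g: "g \<in> carrier M" "carrier M \<subseteq> range (\<lambda>u. u \<odot>\<^bsub>M\<^esub> g)"
    and j: "Suc j < k"
    and lam': "lam' (Suc j) = lam (Suc (Suc j)) + 1" "lam' (Suc (Suc j)) = lam (Suc j) - 1"
      "\<And>i. i \<noteq> Suc j \<Longrightarrow> i \<noteq> Suc (Suc j) \<Longrightarrow> lam' i = lam i"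
  shows "\<exists>G. ab_flag M k G lam'"
proof -
  note fl = ab_flagD[OF flag]
  obtain r p where r: "ab_quotient_map M (F j) (F (Suc j)) (lam (Suc j)) r"
    and p: "ab_quotient_map M (F (Suc j)) (F (Suc (Suc j))) (lam (Suc (Suc j))) p"
    using fl(4) j Suc_lessD by metis
  have sub: "submodule (F j) Atilde M" "submodule (F (Suc j)) Atilde M" "submodule (F (Suc (Suc j))) Atilde M"
    using fl(1) j by auto
  obtain x where x: "x \<in> F (Suc (Suc j))" "p x = 1"
    using ab_quotient_mapD(6)[OF p sub(3)] by blast
  obtain B r' p' where B: "submodule B Atilde M"
    "ab_quotient_map M (F j) B (lam (Suc (Suc j)) + 1) r'"
    "ab_quotient_map M B (F (Suc (Suc j))) (lam (Suc j) - 1) p'"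
    using exchange[OF sub r p x superdiagonal_unit[OF flag g j r p x]
        resonant_entry_zero[OF flag sep j r p x]] by blast
  define G where "G = F(Suc j := B)"
  have "ab_flag M k G lam'"
    unfolding ab_flag_def
  proof (intro conjI allI impI)
    show "submodule (G i) Atilde M" if "i \<le> k" for i
      using fl(1) B(1) that by (simp add: G_def)
    show "G 0 = {\<zero>\<^bsub>M\<^esub>}" "G k = carrier M"
      using fl(2,3) j by (simp_all add: G_def)
    show "\<exists>q. ab_quotient_map M (G i) (G (Suc i)) (lam' (Suc i)) q" if "i < k" for i
      using fl(4)[OF that] B(2,3) lam' by (cases "i = j"; cases "i = Suc j") (auto simp: G_def)
  qed
  then show ?thesis by blast
qed

end

section \<open>Permutations\<close>

text \<open>The transposition of i and j + 1 is the conjugate of that of i and j by the adjacent one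
  of j and j + 1, and transpositions generate all permutations.\<close>

lemma adjacent_transpositions_closed:
  fixes P :: "(nat \<Rightarrow> 'a) \<Rightarrow> bool"
  assumes adj: "\<And>c i. \<lbrakk>P c; 1 \<le> i; i < k\<rbrakk> \<Longrightarrow> P (c \<circ> Transposition.transpose i (Suc i))"
    and "\<sigma> permutes {1..k}" "P c"
  shows "P (c \<circ> \<sigma>)"
proof -
  have tr: "P (c \<circ> Transposition.transpose i j)" if "P c" "1 \<le> i" "i < j" "j \<le> k" for c i j
    using that(3,1,4)
  proof (induction j arbitrary: c)
    case (Suc j)
    show ?case
    proof (cases "i = j")
      case True
      then show ?thesis using adj[of c i] Suc.prems that(2) by (simp add: comp_def)
    next
      case False
      let ?t = "Transposition.transpose j (Suc j)"
      have "P (c \<circ> ?t \<circ> Transposition.transpose i j \<circ> ?t)"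
        using Suc that(2) False by (intro adj Suc.IH) auto
      moreover have "?t \<circ> Transposition.transpose i j \<circ> ?t = Transposition.transpose i (Suc j)"
        using Suc.prems False by (auto simp: fun_eq_iff Transposition.transpose_def)
      ultimately have "P (c \<circ> Transposition.transpose i (Suc j))"
        by (simp add: comp_assoc)
      then show ?thesis
        by (simp add: comp_def)
    qed
  qed simp
  have "finite {1..k}" by simp
  from this assms(2) show ?thesis
  proof (induction \<sigma> rule: permutes_rev_induct)
    case id
    then show ?case using assms(3) by simp
  next
    case (swap a b p)
    then show ?case
      using tr[of "c \<circ> p" a b] tr[of "c \<circ> p" b a]
      by (cases "a < b") (auto simp: comp_def transpose_commute[of b a])
  qed
qed

theorem lemma2p3p2:
  fixes E :: "(ab_series, 'm) module"
    and k :: nat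
    and F :: "nat \<Rightarrow> 'm set"
    and lam mu :: "nat \<Rightarrow> complex"
  assumes "fresco E"
    and "semi_simple E"
    and "ab_module_of_rank k E"
    and "jordan_hoelder E k F"
    and "quotients_isomorphic E k F lam"
    and "twisted_permutation k mu lam"
  shows "\<exists>G. jordan_hoelder E k G \<and> quotients_isomorphic E k G mu"
proof -
  interpret ab_left_module E
    using assms(3) by (simp add: ab_module_of_rank_def ab_left_module_def)
  have sep: "\<exists>h p. ab_functional E h p \<and> p x \<noteq> 0" if "x \<in> carrier E" "x \<noteq> \<zero>\<^bsub>E\<^esub>" for x
    by (rule semi_simple_functionals[OF assms(2) ab_left_module_axioms that])
  obtain g where g: "g \<in> carrier E" "carrier E \<subseteq> range (\<lambda>u. u \<odot>\<^bsub>E\<^esub> g)"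
    using assms(1) by (auto simp: fresco_def)
  obtain \<sigma> where \<sigma>: "\<sigma> permutes {1..k}"
    "\<And>j. j \<in> {1..k} \<Longrightarrow> mu j + of_nat j = lam (\<sigma> j) + of_nat (\<sigma> j)"
    using assms(6) by (auto simp: twisted_permutation_def)
  \<comment> \<open>Adding the index to the numbers turns the exchange of (\<alpha>, \<beta>) into
    (\<beta> + 1, \<alpha> - 1) into a plain swap of neighbours.\<close>
  define P where "P c \<longleftrightarrow> (\<exists>G. ab_flag E k G (\<lambda>i. c i - of_nat i))" for c
  have "P (c \<circ> Transposition.transpose i (Suc i))" if c: "P c" and i: "1 \<le> i" "i < k" for c i
  proof -
    obtain G where G: "ab_flag E k G (\<lambda>i. c i - of_nat i)"
      using c by (auto simp: P_def)
    obtain j where j: "i = Suc j"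
      using i(1) by (cases i) auto
    show ?thesis
      unfolding P_def using i(2) by (intro ab_flag_exchange[OF G sep g, of j]) (auto simp: j)
  qed
  moreover have "P (\<lambda>i. lam i + of_nat i)"
    using assms(4,5) jordan_hoelder_iff_ab_flag[of k F lam] by (auto simp: P_def)
  ultimately have "P ((\<lambda>i. lam i + of_nat i) \<circ> \<sigma>)"
    using adjacent_transpositions_closed[of P k \<sigma>] \<sigma>(1) by blast
  then obtain G where G: "ab_flag E k G (\<lambda>i. lam (\<sigma> i) + of_nat (\<sigma> i) - of_nat i)"
    by (auto simp: P_def)
  have "mu j = lam (\<sigma> j) + of_nat (\<sigma> j) - of_nat j" if "j \<in> {1..k}" for j
    using \<sigma>(2)[OF that] by (simp add: eq_diff_eq)
  \<comment> \<open>A flag evaluates its numbers only at the indices 1 to k, where mu agrees with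
    the permuted sequence.\<close>
  then have "ab_flag E k G mu"
    using G by (auto simp: ab_flag_def)
  then show ?thesis
    using jordan_hoelder_iff_ab_flag by blast
qed

end
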